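(* Fix $k=2$ or $k=3$. For $\chi>0$ let $\{p_n\}$, $\{s_n\}=\{s_n(\cdot;\chi)\}$ be the monic Legendre and monic Sobolev-Legendre orthogonal polynomials of the family $k$. There exists a constant $C>0$ (independent of $n$ and $\chi$) such that for all $n\ge1$ and all $\chi>0$ $$\|\Delta s_n\|_2^2\le\left(1+\chi^{-1}\|G\|_2^2\right)\|p_{n-1}\|_2^2,\qquad \|s_n\|_\infty\le C\left(1+\chi^{-1/2}\right)\|p_{n-1}\|_2.$$
   Context: Sierpinski gasket: let $q_0=(\tfrac12,\tfrac{\sqrt3}{2})$, $q_1=(0,0)$, $q_2=(1,0)$, $V_0=\{q_0,q_1,q_2\}$, $F_i(x)=\tfrac12(x-q_i)+q_i$, and let $SG\subset\mathbb R^2$ be the unique nonempty compact set with $SG=\bigcup_{i=0}^2F_i(SG)$. For a word $w=(w_1,\dots,w_m)\in\{0,1,2\}^m$, $|w|=m$, put $F_w=F_{w_1}\circ\cdots\circ F_{w_m}$; $F_w(SG)$ is called an $m$-cell; $V_m=\bigcup_{|w|=m}F_w(V_0)$; distinct $x,y\in V_m$ satisfy $x\sim_m y$ if they lie in a common $m$-cell. $\mu$ is the self-similar Borel probability measure with $\mu(F_w(SG))=3^{-|w|}$. All functions are real-valued. Energy and Laplacian: $\mathscr E(u,v)=\lim_{m\to\infty}(3/5)^{-m}\sum_{x\sim_m y}(u(x)-u(y))(v(x)-v(y))$ (sum over unordered pairs), and $u\in\operatorname{dom}\mathscr E$ if $\mathscr E(u,u)$ exists and is finite. For $u\in\operatorname{dom}\mathscr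 E$ and $f$ continuous, $\Delta u=f$ means $\mathscr E(u,v)=-\int_{SG}fv\,d\mu$ for all $v\in\operatorname{dom}\mathscr E$ vanishing on $V_0$. Indices of $q_i$ are mod 3. Normal derivative: $\partial_nu(q_i)=\lim_m(5/3)^m(2u(q_i)-u(F_i^mq_{i+1})-u(F_i^mq_{i-1}))$. Tangential derivative: $\partial_Tu(q_i)=\lim_m5^m(u(F_i^mq_{i+1})-u(F_i^mq_{i-1}))$. Green's function: $G(x,y)$ is the (continuous, symmetric) Green's function of the Dirichlet problem: for $f$ continuous, $-\Delta u=f$ and $u|_{V_0}=0$ iff $u(x)=\int_{SG}G(x,y)f(y)\,d\mu(y)$. $\|G\|_2$ is the norm of $G$ in $L^2(SG\times SG,\mu\times\mu)$. Monomials: for $j\ge0$, $k\in\{1,2,3\}$, $P_{j,k}$ is the unique function with $\Delta^{j+1}P_{j,k}=0$ such that for all $0\le n\le j$: $\Delta^nP_{j,k}(q_0)=\delta_{nj}\delta_{k1}$, $\partial_n\Delta^nP_{j,k}(q_0)=\delta_{nj}\delta_{k2}$, $\partial_T\Delta^nP_{j,k}(q_0)=\delta_{nj}\delta_{k3}$. In particular $\Delta P_{j,k}=P_{j-1,k}$ with $P_{-1,k}=0$. Inner products: $\langle f,g\rangle_2=\int_{SG}fg\,d\mu$ with norm $\|\cdot\|_2$; $\|\cdot\|_\infty$ is the sup norm on $SG$; $\langle f,g\rangle_S=\int_{SG}fg\,d\mu+\chi\int_{SG}\Delta f\,\Delta g\,d\mu$. For fixed $k$, $\{p_{n}\}$ (monic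 Legendre) and $\{s_{n}\}$ (monic Sobolev-Legendre) are obtained from $P_{0,k},P_{1,k},\dots$ by Gram-Schmidt without normalization with respect to $\langle\cdot,\cdot\rangle_2$ and $\langle\cdot,\cdot\rangle_S$ respectively; i.e. each of $p_{n}$, $s_{n}$ equals $P_{n,k}$ plus a linear combination of $P_{0,k},\dots,P_{n-1,k}$ and is orthogonal to $P_{0,k},\dots,P_{n-1,k}$. *)

theory Defs
  imports "HOL-Probability.Probability"
begin

type_synonym plane = "real ^ 2"

section \<open>The Sierpinski gasket\<close>

text \<open>Vertices and maps are indexed by the type \<open>3\<close> of integers modulo 3, so that \<open>i + 1\<close> and
  \<open>i - 1\<close> are the cyclic neighbours of the index \<open>i\<close>.\<close>

definition sg_vertex :: "3 \<Rightarrow> plane" where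
  "sg_vertex i =
     (if i = 0 then vector [1 / 2, sqrt 3 / 2] else if i = 1 then vector [0, 0] else vector [1, 0])"

definition sg_boundary :: "plane set" where
  "sg_boundary = range sg_vertex"

definition sg_map :: "3 \<Rightarrow> plane \<Rightarrow> plane" where
  "sg_map i x = (1 / 2) *\<^sub>R (x - sg_vertex i) + sg_vertex i"

definition SG :: "plane set" where
  "SG = (THE K. compact K \<and> K \<noteq> {} \<and> K = (\<Union>i. sg_map i ` K))"

primrec sg_word_map :: "3 list \<Rightarrow> plane \<Rightarrow> plane" where
  "sg_word_map [] = id"
| "sg_word_map (i # w) = sg_map i \<circ> sg_word_map w"

definition sg_cell :: "3 list \<Rightarrow> plane set" where
  "sg_cell w = sg_word_map w ` SG"

definition sg_vertices :: "nat \<Rightarrow> plane set" where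
  "sg_vertices m = (\<Union>w\<in>{w. length w = m}. sg_word_map w ` sg_boundary)"

definition sg_adjacent :: "nat \<Rightarrow> plane \<Rightarrow> plane \<Rightarrow> bool" where
  "sg_adjacent m x y \<longleftrightarrow> x \<in> sg_vertices m \<and> y \<in> sg_vertices m \<and> x \<noteq> y \<and>
     (\<exists>w. length w = m \<and> x \<in> sg_cell w \<and> y \<in> sg_cell w)"

text \<open>The measure lives on the Borel subsets of \<open>SG\<close> (its space is \<open>SG\<close>), so integrals with respect
  to it do not see the values of a function outside \<open>SG\<close>. The values on cells determine it.\<close>

definition sg_measure :: "plane measure" where
  "sg_measure = (THE M. prob_space M \<and> sets M = sets (restrict_space borel SG) \<and>
     (\<forall>w. measure M (sg_cell w) = 1 / 3 ^ length w))"


section \<open>Energy and Laplacian\<close>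

text \<open>Functions on \<open>SG\<close> are represented by functions on the plane whose values outside \<open>SG\<close> are
  irrelevant.\<close>

text \<open>The factor \<open>1 / 2\<close> turns the sum over ordered pairs into one over unordered pairs.\<close>

definition graph_energy :: "nat \<Rightarrow> (plane \<Rightarrow> real) \<Rightarrow> (plane \<Rightarrow> real) \<Rightarrow> real" where
  "graph_energy m u v =
     (5 / 3) ^ m * ((1 / 2) * (\<Sum>(x, y)\<in>{(x, y). sg_adjacent m x y}. (u x - u y) * (v x - v y)))"

definition energy :: "(plane \<Rightarrow> real) \<Rightarrow> (plane \<Rightarrow> real) \<Rightarrow> real" where
  "energy u v = lim (\<lambda>m. graph_energy m u v)"

text \<open>A function of finite energy on the vertices of all levels is uniformly continuous there and is
  identified, as usual, with its continuous extension to \<open>SG\<close>. Without continuity, the values off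
  the countable set of vertices would be unconstrained and the weak formulation of the Laplacian
  below would be meaningless.\<close>

definition energy_domain :: "(plane \<Rightarrow> real) set" where
  "energy_domain = {u. continuous_on SG u \<and> convergent (\<lambda>m. graph_energy m u u)}"

definition l2_inner :: "(plane \<Rightarrow> real) \<Rightarrow> (plane \<Rightarrow> real) \<Rightarrow> real" where
  "l2_inner f g = (\<integral>x. f x * g x \<partial>sg_measure)"

definition has_laplacian :: "(plane \<Rightarrow> real) \<Rightarrow> (plane \<Rightarrow> real) \<Rightarrow> bool" where
  "has_laplacian u f \<longleftrightarrow> u \<in> energy_domain \<and> continuous_on SG f \<and>
     (\<forall>v\<in>energy_domain. (\<forall>x\<in>sg_boundary. v x = 0) \<longrightarrow> energy u v = - l2_inner f v)"

definition laplacian_domain :: "(plane \<Rightarrow> real) set" where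
  "laplacian_domain = {u. \<exists>f. has_laplacian u f}"

text \<open>The Laplacian of a function is determined on \<open>SG\<close> only; it is extended by \<open>0\<close>.\<close>

definition laplacian :: "(plane \<Rightarrow> real) \<Rightarrow> plane \<Rightarrow> real" where
  "laplacian u = (THE f. has_laplacian u f \<and> (\<forall>x. x \<notin> SG \<longrightarrow> f x = 0))"

definition has_normal_derivative :: "(plane \<Rightarrow> real) \<Rightarrow> real \<Rightarrow> 3 \<Rightarrow> bool" where
  "has_normal_derivative u d i \<longleftrightarrow>
     (\<lambda>m. (5 / 3) ^ m * (2 * u (sg_vertex i) - u ((sg_map i ^^ m) (sg_vertex (i + 1)))
                          - u ((sg_map i ^^ m) (sg_vertex (i - 1))))) \<longlonglongrightarrow> d"

definition has_tangential_derivative :: "(plane \<Rightarrow> real) \<Rightarrow> real \<Rightarrow> 3 \<Rightarrow> bool" where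
  "has_tangential_derivative u d i \<longleftrightarrow>
     (\<lambda>m. 5 ^ m * (u ((sg_map i ^^ m) (sg_vertex (i + 1)))
                    - u ((sg_map i ^^ m) (sg_vertex (i - 1))))) \<longlonglongrightarrow> d"


section \<open>Green's function, monomials and orthogonal polynomials\<close>

definition green_function :: "(plane \<Rightarrow> plane \<Rightarrow> real) \<Rightarrow> bool" where
  "green_function G \<longleftrightarrow>
     continuous_on (SG \<times> SG) (\<lambda>(x, y). G x y) \<and>
     (\<forall>x\<in>SG. \<forall>y\<in>SG. G x y = G y x) \<and>
     (\<forall>f u. continuous_on SG f \<longrightarrow>
        (has_laplacian u (\<lambda>x. - f x) \<and> (\<forall>x\<in>sg_boundary. u x = 0) \<longleftrightarrow>
         (\<forall>x\<in>SG. u x = (\<integral>y. G x y * f y \<partial>sg_measure))))"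

text \<open>\<open>monomial_function j k u\<close> says that \<open>u\<close> is the monomial \<open>P\<^sub>j\<^sub>,\<^sub>k\<close> based at the vertex of
  index \<open>0\<close>, for \<open>k \<in> {1, 2, 3}\<close>. These conditions determine \<open>u\<close> on \<open>SG\<close>.\<close>

definition monomial_function :: "nat \<Rightarrow> nat \<Rightarrow> (plane \<Rightarrow> real) \<Rightarrow> bool" where
  "monomial_function j k u \<longleftrightarrow>
     (\<forall>n\<le>j. (laplacian ^^ n) u \<in> laplacian_domain) \<and>
     (\<forall>x\<in>SG. (laplacian ^^ (j + 1)) u x = 0) \<and>
     (\<forall>n\<le>j. (laplacian ^^ n) u (sg_vertex 0) = of_bool (n = j \<and> k = 1) \<and>
        has_normal_derivative ((laplacian ^^ n) u) (of_bool (n = j \<and> k = 2)) 0 \<and>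
        has_tangential_derivative ((laplacian ^^ n) u) (of_bool (n = j \<and> k = 3)) 0)"

definition l2_norm :: "(plane \<Rightarrow> real) \<Rightarrow> real" where
  "l2_norm f = sqrt (l2_inner f f)"

definition l2_norm_kernel :: "(plane \<Rightarrow> plane \<Rightarrow> real) \<Rightarrow> real" where
  "l2_norm_kernel G = sqrt (\<integral>(x, y). (G x y)\<^sup>2 \<partial>(sg_measure \<Otimes>\<^sub>M sg_measure))"

definition sup_norm :: "(plane \<Rightarrow> real) \<Rightarrow> real" where
  "sup_norm f = (SUP x\<in>SG. \<bar>f x\<bar>)"

definition sobolev_inner :: "real \<Rightarrow> (plane \<Rightarrow> real) \<Rightarrow> (plane \<Rightarrow> real) \<Rightarrow> real" where
  "sobolev_inner chi f g = l2_inner f g + chi * l2_inner (laplacian f) (laplacian g)"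

fun gram_schmidt_monic ::
  "((plane \<Rightarrow> real) \<Rightarrow> (plane \<Rightarrow> real) \<Rightarrow> real) \<Rightarrow> (nat \<Rightarrow> plane \<Rightarrow> real) \<Rightarrow> nat \<Rightarrow> plane \<Rightarrow> real" where
  "gram_schmidt_monic ip P n =
     (\<lambda>x. P n x - (\<Sum>i<n. ip (P n) (gram_schmidt_monic ip P i) /
        ip (gram_schmidt_monic ip P i) (gram_schmidt_monic ip P i) * gram_schmidt_monic ip P i x))"

declare gram_schmidt_monic.simps [simp del]

definition legendre :: "(nat \<Rightarrow> plane \<Rightarrow> real) \<Rightarrow> nat \<Rightarrow> plane \<Rightarrow> real" where
  "legendre P = gram_schmidt_monic l2_inner P"

definition sobolev_legendre :: "real \<Rightarrow> (nat \<Rightarrow> plane \<Rightarrow> real) \<Rightarrow> nat \<Rightarrow> plane \<Rightarrow> real" where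
  "sobolev_legendre chi P = gram_schmidt_monic (sobolev_inner chi) P"

end

theory Submission
  imports Defs
begin

text \<open>The Sobolev-Legendre polynomial \<open>s\<^sub>n\<close> minimizes the Sobolev norm among the functions
  \<open>P\<^sub>n + span {P\<^sub>0, \<dots>, P\<^sub>n\<^sub>-\<^sub>1}\<close>. A competitor is the primitive \<open>q\<close> of \<open>p\<^sub>n\<^sub>-\<^sub>1\<close>, that is
  \<open>\<Delta> q = p\<^sub>n\<^sub>-\<^sub>1\<close>, that vanishes on the boundary: all \<open>P\<^sub>j\<close> vanish at \<open>q\<^sub>0\<close> and are symmetric
  (\<open>k = 2\<close>) or antisymmetric (\<open>k = 3\<close>) under the reflection fixing \<open>q\<^sub>0\<close>, so a multiple of the
  harmonic function \<open>P\<^sub>0\<close> corrects the other two boundary values. Since \<open>q\<close> is the Green potential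
  of \<open>- p\<^sub>n\<^sub>-\<^sub>1\<close>, its \<open>L\<^sup>2\<close> norm is at most the product of the norms of \<open>G\<close> and \<open>p\<^sub>n\<^sub>-\<^sub>1\<close>; this is the
  first estimate. For the second, \<open>s\<^sub>n\<close> is the Green potential of \<open>- \<Delta> s\<^sub>n\<close> plus a multiple of \<open>P\<^sub>0\<close>,
  whose coefficient is controlled because \<open>s\<^sub>n\<close> is \<open>L\<^sup>2\<close>-orthogonal to \<open>P\<^sub>0\<close>. That the Laplacian is
  single-valued and that the \<open>P\<^sub>j\<close> are unique rests on an explicit construction of the harmonic
  functions.\<close>

text \<open>The gasket, its measure and the Laplacian are given by definite descriptions, so each
  needs existence and uniqueness before any property can be used. The Green function is a hypothesis
  and serves twice: with zero data it gives uniqueness for the Dirichlet problem, and as an integral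
  kernel it gives the norm bounds. About the \<open>P j\<close> only their jets at q_0 are known;
  uniqueness from the jet yields both the rule that \<open>P (Suc j)\<close> has Laplacian
  \<open>P j\<close> and the parity under reflection. Parity matters because a multiple of the
  single function \<open>P 0\<close> can repair only one boundary value: vanishing at q_0 and parity
  reduce three values to one. With N the norm of G, comparison with q gives chi ||Delta s_n||^2 <=
  (N^2 + chi) ||p_(n-1)||^2, and division by chi produces the stated factor. The constant of the
  second estimate is free of chi because Delta P_0 = 0, so that Sobolev orthogonality to P_0 is
  plain L^2 orthogonality.\<close>

lemma UNIV_mod3: "(UNIV :: 3 set) = {0, 1, 2}"
  using UNIV_3 by auto

lemma cases_mod3: "(i :: 3) = 0 \<or> i = 1 \<or> i = 2"
  using exhaust_3[of i] by auto

lemma mod3_cases [case_names zero one two]: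
  fixes i :: 3
  obtains "i = 0" | "i = 1" | "i = 2"
  using cases_mod3[of i] by auto

lemma mod3_arith [simp]:
  "(1::3) + 1 = 2" "(2::3) + 1 = 0" "(1::3) + 2 = 0" "(2::3) + 2 = 1" "- (1::3) = 2" "- (2::3) = 1"
proof -
  show "(1::3) + 1 = 2" "(2::3) + 1 = 0" "(1::3) + 2 = 0" "(2::3) + 2 = 1"
    by simp_all
  show "- (1::3) = 2" "- (2::3) = 1"
    by (rule minus_unique, simp)+
qed

lemma sum_mod3: "sum f (UNIV :: 3 set) = f 0 + f 1 + f 2"
proof -
  have "(3::3) = 0"
    by simp
  then show ?thesis
    using sum_3[of f] by (metis add.assoc add.commute)
qed

section \<open>Geometry of the gasket\<close>

lemma plane_eq_iff: "(x :: plane) = y \<longleftrightarrow> x $ 1 = y $ 1 \<and> x $ 2 = y $ 2"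
  by (simp add: vec_eq_iff forall_2)

text \<open>Barycentric coordinates with respect to the three corners. In these coordinates
  \<open>sg_map i\<close> halves everything and adds 1/2 to coordinate \<open>i\<close>, so the
  incidences between cells become linear inequalities.\<close>

definition bary :: "3 \<Rightarrow> plane \<Rightarrow> real" where
  "bary i x = (if i = 0 then 2 * x $ 2 / sqrt 3
     else if i = 1 then 1 - x $ 1 - x $ 2 / sqrt 3 else x $ 1 - x $ 2 / sqrt 3)"

lemma bary_vertex: "bary i (sg_vertex j) = of_bool (i = j)"
  by (cases i rule: mod3_cases; cases j rule: mod3_cases) (simp_all add: bary_def sg_vertex_def)

lemma sum_bary: "(\<Sum>i\<in>UNIV. bary i x) = 1"
  by (simp add: sum_mod3 bary_def)

lemma bary_inject:
  assumes "\<And>i. bary i x = bary i y"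
  shows "x = y"
proof -
  have *: "x $ 2 = y $ 2"
    using assms[of 0] by (simp add: bary_def)
  then have "x $ 1 = y $ 1"
    using assms[of 2] by (simp add: bary_def)
  with * show ?thesis
    by (simp add: plane_eq_iff)
qed

lemma continuous_on_bary: "continuous_on S (bary i)"
  unfolding bary_def by (cases i rule: mod3_cases) (auto intro!: continuous_intros)

lemma sg_map_eq: "sg_map i x = (1 / 2) *\<^sub>R (x + sg_vertex i)"
  by (simp add: sg_map_def plane_eq_iff field_simps)

lemma bary_sg_map: "bary j (sg_map i x) = (bary j x + of_bool (j = i)) / 2"
proof -
  have "bary j (sg_map i x) = (bary j x + bary j (sg_vertex i)) / 2"
    by (cases j rule: mod3_cases) (simp_all add: sg_map_eq bary_def add_divide_distrib diff_divide_distrib)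
  then show ?thesis
    by (simp add: bary_vertex)
qed

lemma inj_sg_map: "inj (sg_map i)"
  by (rule injI) (simp add: sg_map_eq)

lemma sg_map_inject [simp]: "sg_map i x = sg_map i y \<longleftrightarrow> x = y"
  using inj_sg_map by (auto dest: injD)

lemma inj_sg_vertex: "inj sg_vertex"
proof (rule injI)
  fix i j assume "sg_vertex i = sg_vertex j"
  then have "bary i (sg_vertex i) = bary i (sg_vertex j)"
    by simp
  then show "i = j"
    by (simp add: bary_vertex split: if_splits)
qed

lemma sg_map_vertex [simp]: "sg_map i (sg_vertex i) = sg_vertex i"
  by (simp add: sg_map_def)

lemma sg_map_vertex_commute: "sg_map i (sg_vertex j) = sg_map j (sg_vertex i)"
  by (simp add: sg_map_eq add.commute)

lemma dist_sg_map [simp]: "dist (sg_map i x) (sg_map i y) = dist x y / 2"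
  by (simp add: sg_map_eq dist_norm flip: scaleR_diff_right)

lemma continuous_on_sg_map [continuous_intros]:
  "continuous_on S f \<Longrightarrow> continuous_on S (\<lambda>x. sg_map i (f x))"
  unfolding sg_map_eq by (intro continuous_intros)

definition sg_map_inv :: "3 \<Rightarrow> plane \<Rightarrow> plane" where
  "sg_map_inv i x = 2 *\<^sub>R x - sg_vertex i"

lemma sg_map_inv [simp]: "sg_map_inv i (sg_map i x) = x" "sg_map i (sg_map_inv i x) = x"
  by (simp_all add: sg_map_inv_def sg_map_eq)

lemma continuous_on_sg_map_inv: "continuous_on S (sg_map_inv i)"
  unfolding sg_map_inv_def by (intro continuous_intros)

text \<open>An address \<open>s\<close> is sent to the point \<open>lim F\<^sub>s\<^sub>0 (F\<^sub>s\<^sub>1 (\<dots> ))\<close>, written as a series.\<close>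

definition coding :: "3 stream \<Rightarrow> plane" where
  "coding s = (\<Sum>n. (1 / 2) ^ Suc n *\<^sub>R sg_vertex (s !! n))"

lemma norm_sg_vertex_le: "norm (sg_vertex i) \<le> 2"
proof -
  have "norm (sg_vertex i) \<le> \<bar>sg_vertex i $ 1\<bar> + \<bar>sg_vertex i $ 2\<bar>"
    using norm_le_l1_cart[of "sg_vertex i"] by (simp add: sum_2)
  also have "\<dots> \<le> 2"
    using real_sqrt_le_mono[of 3 4] by (cases i rule: mod3_cases) (simp_all add: sg_vertex_def)
  finally show ?thesis .
qed

lemma summable_coding_bound: "summable (\<lambda>n. (1 / 2) ^ n :: real)"
  by (rule summable_geometric) simp

lemma norm_coding_term_le: "norm ((1 / 2) ^ Suc n *\<^sub>R sg_vertex i) \<le> (1 / 2) ^ n"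
  using mult_left_mono[OF norm_sg_vertex_le, of "(1 / 2) ^ Suc n" i] by simp

lemma summable_coding: "summable (\<lambda>n. (1 / 2) ^ Suc n *\<^sub>R sg_vertex (s !! n))"
  by (rule summable_comparison_test'[OF summable_coding_bound, of 0]) (rule norm_coding_term_le)

lemma norm_coding_le: "norm (coding s) \<le> 2"
proof -
  have "norm (coding s) \<le> (\<Sum>n. (1 / 2) ^ n :: real)"
    unfolding coding_def
    by (rule norm_suminf_le[OF norm_coding_term_le summable_coding_bound])
  then show ?thesis
    by (simp add: suminf_geometric)
qed

lemma coding_Stream: "coding (i ## s) = sg_map i (coding s)"
proof -
  let ?f = "\<lambda>s n. (1 / 2) ^ Suc n *\<^sub>R sg_vertex (s !! n)"
  have "coding (i ## s) = (\<Sum>n. ?f (i ## s) (Suc n)) + ?f (i ## s) 0"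
    unfolding coding_def using suminf_split_head[OF summable_coding, of "i ## s"] by simp
  also have "(\<Sum>n. ?f (i ## s) (Suc n)) = (\<Sum>n. (1 / 2) *\<^sub>R ?f s n)"
    by simp
  also have "\<dots> = (1 / 2) *\<^sub>R coding s"
    unfolding coding_def by (rule suminf_scaleR_right[OF summable_coding, symmetric])
  finally show ?thesis
    by (simp add: sg_map_eq scaleR_add_right)
qed

text \<open>The set of all coded points is already self-similar, since prefixing a letter applies
  the corresponding map. Closure commutes with finite unions and with similarities, and the uniform
  bound on \<open>coding\<close> makes the closure compact. That \<open>K\<close> contains the coded
  points is recorded because the measure is later built from random addresses.\<close>

lemma ex_attractor: "\<exists>K. compact K \<and> range coding \<subseteq> K \<and> K = (\<Union>i. sg_map i ` K)"
proof -
  have step: "range coding = (\<Union>i. sg_map i ` range coding)"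
  proof
    show "range coding \<subseteq> (\<Union>i. sg_map i ` range coding)"
    proof clarify
      fix s :: "3 stream"
      have "coding s = sg_map (shd s) (coding (stl s))"
        using coding_Stream[of "shd s" "stl s"] by simp
      then show "coding s \<in> (\<Union>i. sg_map i ` range coding)"
        by blast
    qed
  qed (auto simp flip: coding_Stream)
  have cl: "sg_map i ` closure S = closure (sg_map i ` S)" for i S
  proof -
    have "closure ((\<lambda>x. sg_vertex i /\<^sub>R 2 + x) ` ((\<lambda>x. (1 / 2) *\<^sub>R x) ` S)) =
        (\<lambda>x. sg_vertex i /\<^sub>R 2 + x) ` (\<lambda>x. (1 / 2) *\<^sub>R x) ` closure S"
      by (simp only: closure_translation closure_scaleR)
    moreover have "sg_map i = (\<lambda>x. sg_vertex i /\<^sub>R 2 + x) \<circ> (\<lambda>x. (1 / 2) *\<^sub>R x)"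
      by (rule ext) (simp add: sg_map_eq scaleR_add_right)
    ultimately show ?thesis
      by (simp add: image_comp)
  qed
  have "closure (range coding) = closure (\<Union>i. sg_map i ` range coding)"
    using step by (rule arg_cong)
  also have "\<dots> = (\<Union>i. sg_map i ` closure (range coding))"
    by (simp only: closure_Un cl UNIV_mod3 UN_insert UN_empty Un_empty_right Un_assoc)
  finally have "closure (range coding) = (\<Union>i. sg_map i ` closure (range coding))" .
  moreover have "compact (closure (range coding))"
    unfolding compact_closure bounded_iff using norm_coding_le by auto
  ultimately show ?thesis
    by (intro exI[of _ "closure (range coding)"] conjI closure_subset)
qed

text \<open>Take the point of \<open>K\<close> farthest from \<open>L\<close>. It is the image of a
  point of \<open>K\<close> under some \<open>sg_map i\<close>, which maps \<open>L\<close> into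
  itself and halves distances, so the largest distance is at most half of itself.\<close>

lemma attractor_subset:
  assumes K: "compact K" "K \<noteq> {}" "K = (\<Union>i. sg_map i ` K)"
    and L: "compact L" "L \<noteq> {}" "L = (\<Union>i. sg_map i ` L)"
  shows "K \<subseteq> L"
proof -
  have "continuous_on K (\<lambda>x. infdist x L)"
    by (intro continuous_intros)
  then obtain x where x: "x \<in> K" "\<And>y. y \<in> K \<Longrightarrow> infdist y L \<le> infdist x L"
    using continuous_attains_sup[OF K(1,2)] by blast
  from x(1) K(3) obtain i y where y: "y \<in> K" "x = sg_map i y"
    by blast
  obtain z where z: "z \<in> L" "infdist y L = dist y z"
    using infdist_attains_inf[of L y] L(1,2) compact_imp_closed by blast
  have "sg_map i z \<in> L"
    using z(1) L(3) by blast
  then have "infdist x L \<le> dist x (sg_map i z)"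
    by (rule infdist_le)
  also have "\<dots> = infdist y L / 2"
    using y z by simp
  also have "\<dots> \<le> infdist x L / 2"
    using x(2)[OF y(1)] by simp
  finally have "infdist x L = 0"
    using infdist_nonneg[of x L] by linarith
  then have "infdist y L = 0" if "y \<in> K" for y
    using x(2)[OF that] infdist_nonneg[of y L] by linarith
  then show ?thesis
    using in_closed_iff_infdist_zero[OF compact_imp_closed[OF L(1)] L(2)] by blast
qed

lemma SG_attractor: "compact SG \<and> SG \<noteq> {} \<and> SG = (\<Union>i. sg_map i ` SG)"
  unfolding SG_def
proof (rule theI')
  show "\<exists>!K. compact K \<and> K \<noteq> {} \<and> K = (\<Union>i. sg_map i ` K)"
  proof (rule ex_ex1I)
    obtain K where K: "compact K" "range coding \<subseteq> K" "K = (\<Union>i. sg_map i ` K)"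
      using ex_attractor by (elim exE conjE)
    moreover have "K \<noteq> {}"
      using K(2) by blast
    ultimately show "\<exists>K. compact K \<and> K \<noteq> {} \<and> K = (\<Union>i. sg_map i ` K)"
      by (intro exI[of _ K] conjI)
  next
    fix K L
    assume "compact K \<and> K \<noteq> {} \<and> K = (\<Union>i. sg_map i ` K)"
      and "compact L \<and> L \<noteq> {} \<and> L = (\<Union>i. sg_map i ` L)"
    then show "K = L"
      by (elim conjE) (rule equalityI; rule attractor_subset; assumption)
  qed
qed

lemma compact_SG: "compact SG" and SG_nonempty: "SG \<noteq> {}" and SG_eq: "SG = (\<Union>i. sg_map i ` SG)"
  by (rule SG_attractor[THEN conjunct1], rule SG_attractor[THEN conjunct2, THEN conjunct1],
      rule SG_attractor[THEN conjunct2, THEN conjunct2])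

lemma closed_SG: "closed SG"
  using compact_SG compact_imp_closed by blast

lemma SG_eqI:
  assumes "compact K" "K \<noteq> {}" "K = (\<Union>i. sg_map i ` K)"
  shows "K = SG"
proof
  show "K \<subseteq> SG"
    by (rule attractor_subset[OF assms compact_SG SG_nonempty SG_eq])
  show "SG \<subseteq> K"
    by (rule attractor_subset[OF compact_SG SG_nonempty SG_eq assms])
qed

lemma sg_map_in_SG [simp]: "x \<in> SG \<Longrightarrow> sg_map i x \<in> SG"
  by (subst SG_eq) blast

lemma SG_cases:
  assumes "x \<in> SG"
  obtains i y where "y \<in> SG" "x = sg_map i y"
  using SG_eq[THEN equalityD1, THEN subsetD, OF assms] by blast

lemma coding_in_SG: "coding s \<in> SG"
proof -
  obtain K where K: "compact K" "range coding \<subseteq> K" "K = (\<Union>i. sg_map i ` K)"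
    using ex_attractor by (elim exE conjE)
  have "K \<noteq> {}"
    using K(2) by blast
  then have "K = SG"
    using K by (intro SG_eqI)
  with K(2) show ?thesis
    by blast
qed

text \<open>The vertex is the fixed point of \<open>sg_map i\<close>, so this map moves a nearest
  point of \<open>SG\<close> to a point of \<open>SG\<close> at half the distance.\<close>

lemma sg_vertex_in_SG [simp]: "sg_vertex i \<in> SG"
proof -
  obtain x where x: "x \<in> SG" "infdist (sg_vertex i) SG = dist (sg_vertex i) x"
    using infdist_attains_inf[OF closed_SG SG_nonempty] by blast
  have "dist (sg_vertex i) x \<le> dist (sg_vertex i) (sg_map i x)"
    using infdist_le[OF sg_map_in_SG[OF x(1)], of "sg_vertex i" i] x(2) by simp
  also have "\<dots> = dist (sg_vertex i) x / 2"
    using dist_sg_map[of i "sg_vertex i" x] by simp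
  finally have "sg_vertex i = x"
    using zero_le_dist[of "sg_vertex i" x] dist_eq_0_iff[of "sg_vertex i" x] by linarith
  with x(1) show ?thesis
    by simp
qed

text \<open>At a minimizer, the image of \<open>y\<close> say, the coordinate is at least half its
  value at \<open>y\<close>, hence at least half the minimum itself; a number at least half of
  itself is nonnegative.\<close>

lemma bary_nonneg:
  assumes "x \<in> SG"
  shows "0 \<le> bary j x"
proof -
  obtain z where z: "z \<in> SG" "\<And>y. y \<in> SG \<Longrightarrow> bary j z \<le> bary j y"
    using continuous_attains_inf[OF compact_SG SG_nonempty continuous_on_bary] by blast
  obtain i y where y: "y \<in> SG" "z = sg_map i y"
    using SG_cases[OF z(1)] .
  have "bary j z \<ge> bary j y / 2"
    using y(2) by (simp add: bary_sg_map)
  then have "bary j z \<ge> 0"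
    using z(2)[OF y(1)] by linarith
  then show ?thesis
    using z(2)[OF assms] by linarith
qed

lemma bary_eq_1_iff:
  assumes "x \<in> SG"
  shows "bary j x = 1 \<longleftrightarrow> x = sg_vertex j"
proof
  assume 1: "bary j x = 1"
  have sum: "bary 0 x + bary 1 x + bary 2 x = 1"
    using sum_bary[of x] by (simp add: sum_mod3)
  show "x = sg_vertex j"
  proof (rule bary_inject)
    fix i
    show "bary i x = bary i (sg_vertex j)"
      using 1 sum bary_nonneg[OF assms, of 0] bary_nonneg[OF assms, of 1] bary_nonneg[OF assms, of 2]
      by (cases i rule: mod3_cases; cases j rule: mod3_cases) (simp_all add: bary_vertex)
  qed
qed (simp add: bary_vertex)

lemma bary_le_1:
  assumes "x \<in> SG"
  shows "bary j x \<le> 1"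
  using sum_bary[of x] bary_nonneg[OF assms, of 0] bary_nonneg[OF assms, of 1]
    bary_nonneg[OF assms, of 2]
  by (cases j rule: mod3_cases) (simp_all add: sum_mod3)

text \<open>Finite ramification: different cells of level 1 meet in one point. Coordinate
  \<open>i\<close> is at least 1/2 on cell \<open>i\<close> and at most 1/2 on cell
  \<open>j\<close>, so a common point attains both bounds, and this pins down the preimages.\<close>

lemma sg_map_eq_sg_map:
  assumes "x \<in> SG" "y \<in> SG" "sg_map i x = sg_map j y" "i \<noteq> j"
  shows "x = sg_vertex j" "y = sg_vertex i"
proof -
  have eq: "bary k x + of_bool (k = i) = bary k y + of_bool (k = j)" for k
    using assms(3) bary_sg_map[of k i x] bary_sg_map[of k j y] by simp
  have "bary i y = 1" "bary j x = 1"
    using eq[of i] eq[of j] assms(4) bary_nonneg[OF assms(1), of i] bary_nonneg[OF assms(2), of j]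
      bary_le_1[OF assms(1), of j] bary_le_1[OF assms(2), of i] by simp_all
  then show "x = sg_vertex j" "y = sg_vertex i"
    using assms bary_eq_1_iff by auto
qed

lemma sg_map_eq_vertex:
  assumes "x \<in> SG" "sg_map i x = sg_vertex j"
  shows "i = j"
proof (rule ccontr)
  assume "i \<noteq> j"
  then have "bary j x = 2"
    using assms(2) bary_sg_map[of j i x] by (simp add: bary_vertex)
  then show False
    using bary_le_1[OF assms(1), of j] by simp
qed

section \<open>Words and cells\<close>

lemma sg_word_map_in_SG [simp]: "x \<in> SG \<Longrightarrow> sg_word_map w x \<in> SG"
  by (induction w) simp_all

lemma continuous_on_sg_word_map: "continuous_on S (sg_word_map w)"
proof (induction w)
  case (Cons i w)
  then show ?case
    by (simp add: comp_def continuous_on_sg_map)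
qed (simp add: id_def)

lemma compact_sg_cell: "compact (sg_cell w)"
  unfolding sg_cell_def by (intro compact_continuous_image continuous_on_sg_word_map compact_SG)

lemma sg_cell_subset: "sg_cell w \<subseteq> SG"
  by (auto simp: sg_cell_def)

lemma sg_cell_Nil [simp]: "sg_cell [] = SG"
  by (simp add: sg_cell_def)

lemma sg_cell_Cons: "sg_cell (i # w) = sg_map i ` sg_cell w"
  by (simp add: sg_cell_def image_comp)

lemma dist_sg_word_map: "dist (sg_word_map w x) (sg_word_map w y) = dist x y / 2 ^ length w"
  by (induction w) simp_all

lemma SG_eq_Union_cells: "SG = (\<Union>w\<in>{w. length w = n}. sg_cell w)"
proof (induction n)
  case (Suc n)
  have "x \<in> (\<Union>w\<in>{w. length w = Suc n}. sg_cell w)" if x: "x \<in> SG" for x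
  proof -
    obtain i y where y: "y \<in> SG" "x = sg_map i y"
      using SG_cases[OF x] .
    then obtain w where "length w = n" "y \<in> sg_cell w"
      using Suc by blast
    with y show ?thesis
      by (intro UN_I[of "i # w"]) (auto simp: sg_cell_Cons)
  qed
  then show ?case
    using sg_cell_subset by blast
qed simp

lemma uniformly_small_cells:
  assumes "0 < e"
  obtains n where "\<And>w x y. length w = n \<Longrightarrow> x \<in> sg_cell w \<Longrightarrow> y \<in> sg_cell w \<Longrightarrow> dist x y < e"
proof -
  obtain D where D: "\<And>x y. x \<in> SG \<Longrightarrow> y \<in> SG \<Longrightarrow> dist x y \<le> D"
    using compact_imp_bounded[OF compact_SG] unfolding bounded_two_points by blast
  have "(\<lambda>n. D * (1 / 2) ^ n) \<longlonglongrightarrow> D * 0"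
    by (intro tendsto_mult tendsto_const LIMSEQ_power_zero) simp
  then have "\<forall>\<^sub>F n in sequentially. D * (1 / 2) ^ n < e"
    using assms by (intro order_tendstoD) auto
  then obtain n where n: "D * (1 / 2) ^ n < e"
    by (auto simp: eventually_sequentially)
  show ?thesis
  proof (rule that[of n])
    fix w x y assume w: "length w = n" "x \<in> sg_cell w" "y \<in> sg_cell w"
    then obtain a b where ab: "a \<in> SG" "b \<in> SG" "x = sg_word_map w a" "y = sg_word_map w b"
      by (auto simp: sg_cell_def)
    then have "dist x y = dist a b * (1 / 2) ^ n"
      by (simp add: dist_sg_word_map w(1) power_one_over divide_simps)
    also have "\<dots> \<le> D * (1 / 2) ^ n"
      using D[OF ab(1,2)] by (simp add: mult_right_mono)
    finally show "dist x y < e"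
      using n by simp
  qed
qed

lemma ex_small_cell:
  assumes "x \<in> SG" "0 < e"
  obtains w where "x \<in> sg_cell w" "\<And>y. y \<in> sg_cell w \<Longrightarrow> dist y x < e"
proof -
  obtain n where n: "\<And>w x y. length w = n \<Longrightarrow> x \<in> sg_cell w \<Longrightarrow> y \<in> sg_cell w \<Longrightarrow> dist x y < e"
    using uniformly_small_cells[OF assms(2)] by blast
  obtain w where "length w = n" "x \<in> sg_cell w"
    using assms(1) SG_eq_Union_cells[of n] by blast
  with n show ?thesis
    by (intro that) auto
qed

lemma finite_words: "finite {w :: 3 list. length w = n}"
  using finite_lists_length_eq[of "UNIV :: 3 set" n] by simp

lemma card_words: "card {w :: 3 list. length w = n} = 3 ^ n"
  using card_lists_length_eq[of "UNIV :: 3 set" n] by simp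

subsection \<open>Reflection\<close>

text \<open>Reflection in the axis through q_0. It exchanges the vertices of index 1 and 2, which
  modulo 3 is negation of the index; thus it acts on words by \<open>map uminus\<close>.\<close>

definition sg_reflect :: "plane \<Rightarrow> plane" where
  "sg_reflect x = vector [1 - x $ 1, x $ 2]"

lemma sg_reflect_involution [simp]: "sg_reflect (sg_reflect x) = x"
  by (simp add: sg_reflect_def plane_eq_iff)

lemma sg_reflect_vertex [simp]: "sg_reflect (sg_vertex i) = sg_vertex (- i)"
  by (cases i rule: mod3_cases) (simp_all add: sg_reflect_def sg_vertex_def plane_eq_iff)

lemma sg_reflect_map: "sg_reflect (sg_map i x) = sg_map (- i) (sg_reflect x)"
  by (cases i rule: mod3_cases)
    (simp_all add: sg_reflect_def sg_map_eq sg_vertex_def plane_eq_iff field_simps)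

lemma continuous_on_sg_reflect: "continuous_on S sg_reflect"
proof -
  have "sg_reflect = (\<lambda>x. \<chi> i. if i = 1 then 1 - x $ 1 else x $ 2)"
    by (rule ext) (simp add: sg_reflect_def plane_eq_iff)
  moreover have "continuous_on S (\<lambda>x :: plane. \<chi> i. if i = (1::2) then 1 - x $ 1 else x $ 2)"
  proof (rule continuous_on_vec_lambda)
    show "continuous_on S (\<lambda>x :: plane. if i = (1::2) then 1 - x $ 1 else x $ 2)" for i
      by (cases "i = 1") (auto intro!: continuous_intros)
  qed
  ultimately show ?thesis
    by (simp only:)
qed

text \<open>Reflection only permutes the three maps, so the mirror image solves the same fixed point
  equation.\<close>

lemma sg_reflect_SG: "sg_reflect ` SG = SG"
proof (rule SG_eqI)
  show "compact (sg_reflect ` SG)"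
    by (intro compact_continuous_image continuous_on_sg_reflect compact_SG)
  have "sg_reflect ` SG = sg_reflect ` (\<Union>i. sg_map i ` SG)"
    by (rule arg_cong[OF SG_eq])
  also have "\<dots> = (\<Union>i. sg_map (- i) ` sg_reflect ` SG)"
    by (simp add: image_UN image_image sg_reflect_map)
  also have "\<dots> = (\<Union>i\<in>range uminus. sg_map i ` sg_reflect ` SG)"
    by (simp only: image_image)
  also have "range uminus = (UNIV :: 3 set)"
    by (rule surj_uminus)
  finally show "sg_reflect ` SG = (\<Union>i. sg_map i ` sg_reflect ` SG)" .
qed (simp add: SG_nonempty)

lemma sg_reflect_in_SG_iff [simp]: "sg_reflect x \<in> SG \<longleftrightarrow> x \<in> SG"
  by (metis imageI sg_reflect_SG sg_reflect_involution)

lemma sg_reflect_word_map: "sg_reflect (sg_word_map w x) = sg_word_map (map uminus w) (sg_reflect x)"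
  by (induction w) (simp_all add: sg_reflect_map)

lemma sg_reflect_in_cell_iff: "sg_reflect x \<in> sg_cell w \<longleftrightarrow> x \<in> sg_cell (map uminus w)"
proof -
  have "sg_reflect x \<in> sg_cell w" if x: "x \<in> sg_cell (map uminus w)" for x w
  proof -
    obtain y where "y \<in> SG" "x = sg_word_map (map uminus w) y"
      using x by (auto simp: sg_cell_def)
    then show ?thesis
      by (auto simp: sg_cell_def sg_reflect_word_map comp_def intro!: image_eqI[of _ _ "sg_reflect y"])
  qed
  from this[of x w] this[of "sg_reflect x" "map uminus w"] show ?thesis
    by (auto simp: comp_def)
qed

lemma sg_reflect_funpow: "sg_reflect ((sg_map 0 ^^ m) x) = (sg_map 0 ^^ m) (sg_reflect x)"
  by (induction m) (simp_all add: sg_reflect_map)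

section \<open>The self-similar measure\<close>

lemma bounded_on_SG:
  fixes f :: "plane \<Rightarrow> real"
  assumes "continuous_on SG f"
  obtains B where "0 < B" "\<And>x. x \<in> SG \<Longrightarrow> \<bar>f x\<bar> \<le> B"
proof -
  have "bounded (f ` SG)"
    by (intro compact_imp_bounded compact_continuous_image assms compact_SG)
  then show ?thesis
    unfolding bounded_pos using that by auto
qed

text \<open>The condition from the definite description of \<open>sg_measure\<close>, as a locale:
  two candidates can be compared, and a candidate constructed, before \<open>sg_measure\<close>
  itself is known to satisfy it.\<close>

locale gasket_measure = prob_space M for M :: "plane measure" +
  assumes sets_eq: "sets M = sets (restrict_space borel SG)"
    and measure_cell: "measure M (sg_cell w) = 1 / 3 ^ length w"
begin

lemma space_eq: "space M = SG"
  using sets_eq_imp_space_eq[OF sets_eq] by (simp add: space_restrict_space)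

lemma borel_Int_sets: "A \<in> sets borel \<Longrightarrow> SG \<inter> A \<in> sets M"
  unfolding sets_eq sets_restrict_space by blast

lemma cell_sets [measurable]: "sg_cell w \<in> sets M"
  using borel_Int_sets[of "sg_cell w"] sg_cell_subset[of w] compact_sg_cell[of w]
  by (simp add: Int_absorb1 borel_compact)

lemma continuous_measurable: "continuous_on SG f \<Longrightarrow> f \<in> borel_measurable M"
  using borel_measurable_continuous_on_restrict measurable_cong_sets[OF sets_eq refl] by blast

lemma continuous_integrable:
  fixes f :: "plane \<Rightarrow> real"
  assumes "continuous_on SG f"
  shows "integrable M f"
proof -
  obtain B where "\<And>x. x \<in> SG \<Longrightarrow> \<bar>f x\<bar> \<le> B"
    using bounded_on_SG[OF assms] by blast
  then show ?thesis
    by (intro integrable_const_bound[of _ B] continuous_measurable assms AE_I2) (simp add: space_eq)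
qed

lemma integrable_cell_mult:
  fixes f :: "plane \<Rightarrow> real"
  assumes "continuous_on SG f"
  shows "integrable M (\<lambda>x. indicator (sg_cell w) x * f x)"
  using integrable_mult_indicator[OF cell_sets continuous_integrable[OF assms], of w] by simp

text \<open>The cells of a level cover the gasket and their measures add up to 1, so they overlap only in
  null sets.\<close>

lemma AE_sum_cells: "AE x in M. (\<Sum>w | length w = n. indicator (sg_cell w) x) = (1 :: real)"
proof -
  let ?g = "\<lambda>x. (\<Sum>w | length w = n. indicator (sg_cell w) x) - (1 :: real)"
  have int: "integrable M (\<lambda>x. indicator (sg_cell w) x :: real)" for w
    by (intro integrable_real_indicator cell_sets) (simp add: emeasure_eq_measure)
  have "integral\<^sup>L M ?g = (\<Sum>w | length w = n. measure M (sg_cell w)) - 1"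
    using int sets.sets_into_space[OF cell_sets] by (simp add: prob_space Int_absorb2)
  also have "\<dots> = 0"
    by (simp add: measure_cell card_words)
  finally have "integral\<^sup>L M ?g = 0" .
  moreover have "AE x in M. 0 \<le> ?g x"
  proof (rule AE_I2)
    fix x assume "x \<in> space M"
    then obtain v where v: "length v = n" "x \<in> sg_cell v"
      using SG_eq_Union_cells[of n] by (auto simp: space_eq)
    have "indicator (sg_cell v) x \<le> (\<Sum>w | length w = n. indicator (sg_cell w) x :: real)"
      using v by (intro member_le_sum) (auto simp: finite_words)
    with v show "0 \<le> ?g x"
      by simp
  qed
  moreover have "integrable M ?g"
    using int by simp
  ultimately have "AE x in M. ?g x = 0"
    using integral_nonneg_eq_0_iff_AE by blast
  then show ?thesis
    by (rule AE_mp) simp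
qed

text \<open>A Riemann sum with one sample point per cell. It involves the measure only through the
  masses of cells, so it is the same for every candidate measure; this is the source of
  uniqueness.\<close>

lemma integral_approx:
  fixes f :: "plane \<Rightarrow> real"
  assumes f: "continuous_on SG f"
    and e: "\<And>w x y. length w = n \<Longrightarrow> x \<in> sg_cell w \<Longrightarrow> y \<in> sg_cell w \<Longrightarrow> \<bar>f x - f y\<bar> \<le> e"
  shows "\<bar>(\<integral>x. f x \<partial>M) - (\<Sum>w | length w = n. f (sg_word_map w (sg_vertex 0)) / 3 ^ n)\<bar> \<le> e"
proof -
  let ?p = "\<lambda>w. sg_word_map w (sg_vertex 0)"
  have p: "?p w \<in> sg_cell w" for w
    by (simp add: sg_cell_def)
  have "(\<integral>x. f x \<partial>M) = (\<integral>x. (\<Sum>w | length w = n. indicator (sg_cell w) x * f x) \<partial>M)"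
  proof (rule integral_cong_AE)
    show "AE x in M. f x = (\<Sum>w | length w = n. indicator (sg_cell w) x * f x)"
      using AE_sum_cells[of n] by eventually_elim (simp flip: sum_distrib_right)
    show "f \<in> borel_measurable M"
      by (rule continuous_measurable[OF f])
    show "(\<lambda>x. \<Sum>w | length w = n. indicator (sg_cell w) x * f x) \<in> borel_measurable M"
      by (intro borel_measurable_sum borel_measurable_integrable integrable_cell_mult f)
  qed
  also have "\<dots> = (\<Sum>w | length w = n. (\<integral>x. indicator (sg_cell w) x * f x \<partial>M))"
    by (intro Bochner_Integration.integral_sum integrable_cell_mult f)
  finally have eq: "(\<integral>x. f x \<partial>M) = (\<Sum>w | length w = n. (\<integral>x. indicator (sg_cell w) x * f x \<partial>M))" .
  have "\<bar>(\<integral>x. indicator (sg_cell w) x * f x \<partial>M) - f (?p w) / 3 ^ n\<bar> \<le> e / 3 ^ n"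
    if w: "length w = n" for w
  proof -
    have const: "(\<integral>x. indicator (sg_cell w) x * c \<partial>M) = c / 3 ^ n" for c :: real
      using sets.sets_into_space[OF cell_sets, of w] by (simp add: Int_absorb2 measure_cell w)
    have int: "integrable M (\<lambda>x. indicator (sg_cell w) x * c)" for c :: real
      by (intro integrable_cell_mult continuous_on_const)
    have "(\<integral>x. indicator (sg_cell w) x * f x \<partial>M) - f (?p w) / 3 ^ n
      = (\<integral>x. indicator (sg_cell w) x * (f x - f (?p w)) \<partial>M)"
      unfolding right_diff_distrib
        Bochner_Integration.integral_diff[OF integrable_cell_mult[OF f] int] const ..
    also have "\<bar>\<dots>\<bar> \<le> (\<integral>x. \<bar>indicator (sg_cell w) x * (f x - f (?p w))\<bar> \<partial>M)"
      using integral_norm_bound[of M "\<lambda>x. indicator (sg_cell w) x * (f x - f (?p w))"]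
      by (simp only: real_norm_def)
    also have "\<dots> \<le> (\<integral>x. indicator (sg_cell w) x * e \<partial>M)"
    proof (rule integral_mono)
      show "integrable M (\<lambda>x. \<bar>indicator (sg_cell w) x * (f x - f (?p w))\<bar>)"
        by (intro integrable_abs integrable_cell_mult continuous_intros f)
      show "\<bar>indicator (sg_cell w) x * (f x - f (?p w))\<bar> \<le> indicator (sg_cell w) x * e" for x
        using e[OF w _ p, of x] by (auto simp: indicator_def)
    qed (rule int)
    finally show ?thesis
      by (simp only: const)
  qed
  then have "(\<Sum>w | length w = n. \<bar>(\<integral>x. indicator (sg_cell w) x * f x \<partial>M) - f (?p w) / 3 ^ n\<bar>)
      \<le> (\<Sum>w :: 3 list | length w = n. e / 3 ^ n)"
    by (intro sum_mono) simp
  also have "\<dots> = e"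
    by (simp add: card_words)
  finally show ?thesis
    unfolding eq sum_subtractf[symmetric] by (rule order_trans[OF sum_abs])
qed

text \<open>The measure has full support: every neighbourhood of a point of \<open>SG\<close>
  contains a cell, and cells have positive mass.\<close>

lemma integral_eq_0_imp:
  fixes f :: "plane \<Rightarrow> real"
  assumes f: "continuous_on SG f" and nonneg: "\<And>x. x \<in> SG \<Longrightarrow> 0 \<le> f x"
    and int: "(\<integral>x. f x \<partial>M) = 0" and x: "x \<in> SG"
  shows "f x = 0"
proof (rule ccontr)
  assume "f x \<noteq> 0"
  then have pos: "0 < f x"
    using nonneg[OF x] by simp
  then obtain d where d: "0 < d" "\<And>y. y \<in> SG \<Longrightarrow> dist y x < d \<Longrightarrow> \<bar>f y - f x\<bar> < f x"
    using f x unfolding continuous_on_iff dist_real_def by blast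
  obtain w where w: "x \<in> sg_cell w" "\<And>y. y \<in> sg_cell w \<Longrightarrow> dist y x < d"
    using ex_small_cell[OF x d(1)] by blast
  have "AE y in M. f y = 0"
  proof -
    have "AE y in M. 0 \<le> f y"
      by (rule AE_I2) (simp add: nonneg space_eq)
    then show ?thesis
      using integral_nonneg_eq_0_iff_AE[OF continuous_integrable[OF f]] int by simp
  qed
  moreover have "AE y in M. f y = 0 \<longrightarrow> y \<notin> sg_cell w"
    using d(2) w(2) sg_cell_subset[of w] by (intro AE_I2) force
  ultimately have "AE y in M. y \<notin> sg_cell w"
    by eventually_elim simp
  then have "measure M (sg_cell w) = 0"
    using prob_eq_0[OF cell_sets] by simp
  then show False
    by (simp add: measure_cell)
qed

end

lemma gasket_measure_integral_eq:
  fixes f :: "plane \<Rightarrow> real"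
  assumes M: "gasket_measure M" and N: "gasket_measure N" and f: "continuous_on SG f"
  shows "(\<integral>x. f x \<partial>M) = (\<integral>x. f x \<partial>N)"
proof (rule ccontr)
  assume ne: "(\<integral>x. f x \<partial>M) \<noteq> (\<integral>x. f x \<partial>N)"
  define e where "e = \<bar>(\<integral>x. f x \<partial>M) - (\<integral>x. f x \<partial>N)\<bar> / 3"
  have e: "0 < e"
    using ne by (simp add: e_def)
  have "uniformly_continuous_on SG f"
    using compact_uniformly_continuous f compact_SG by blast
  then obtain d where d: "0 < d" "\<And>x y. x \<in> SG \<Longrightarrow> y \<in> SG \<Longrightarrow> dist y x < d \<Longrightarrow> dist (f y) (f x) < e"
    using e unfolding uniformly_continuous_on_def by blast
  obtain n where n: "\<And>w x y. length w = n \<Longrightarrow> x \<in> sg_cell w \<Longrightarrow> y \<in> sg_cell w \<Longrightarrow> dist x y < d"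
    using uniformly_small_cells[OF d(1)] by blast
  have osc: "\<bar>f x - f y\<bar> \<le> e" if xy: "length w = n" "x \<in> sg_cell w" "y \<in> sg_cell w" for w x y
  proof -
    have "dist (f x) (f y) < e"
      using xy sg_cell_subset[of w] n[OF xy] by (intro d(2)) auto
    then show ?thesis
      by (simp add: dist_real_def)
  qed
  from gasket_measure.integral_approx[OF M f, of n e] gasket_measure.integral_approx[OF N f, of n e] osc
  have "\<bar>(\<integral>x. f x \<partial>M) - (\<integral>x. f x \<partial>N)\<bar> \<le> 2 * e"
    by fastforce
  then show False
    using e by (simp add: e_def)
qed

text \<open>Candidates agree on continuous functions, hence on closed sets by approximation, hence
  on all Borel sets because the closed sets are an intersection-stable generator.\<close>

lemma gasket_measure_unique:
  assumes M: "gasket_measure M" and N: "gasket_measure N"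
  shows "M = N"
proof -
  interpret M: gasket_measure M by fact
  interpret N: gasket_measure N by fact
  have id: "(\<lambda>x. x) \<in> M \<rightarrow>\<^sub>M borel" "(\<lambda>x. x) \<in> N \<rightarrow>\<^sub>M borel"
    by (auto intro!: M.continuous_measurable N.continuous_measurable continuous_intros)
  \<comment> \<open>Continuous functions that decrease to the indicator of the closed set
    \<open>C\<close> as \<open>n\<close> grows.\<close>
  define f where "f C n x = max 0 (1 - real n * infdist x C)" for C :: "plane set" and n x
  have lim: "(\<lambda>n. \<integral>x. f C n x \<partial>L) \<longlonglongrightarrow> measure L (SG \<inter> C)"
    if L: "gasket_measure L" and C: "closed C" "C \<noteq> {}" for L C
  proof -
    interpret L: gasket_measure L by fact
    have "(\<lambda>n. \<integral>x. f C n x \<partial>L) \<longlonglongrightarrow> (\<integral>x. indicator (SG \<inter> C) x \<partial>L)"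
    proof (rule integral_dominated_convergence[where w="\<lambda>_. 1"])
      show "f C n \<in> borel_measurable L" for n
        unfolding f_def by (intro L.continuous_measurable continuous_intros)
      show "AE x in L. norm (f C n x) \<le> 1" for n
        by (intro AE_I2) (auto simp: f_def infdist_nonneg)
      show "AE x in L. (\<lambda>n. f C n x) \<longlonglongrightarrow> indicator (SG \<inter> C) x"
      proof (rule AE_I2)
        fix x assume x: "x \<in> space L"
        show "(\<lambda>n. f C n x) \<longlonglongrightarrow> indicator (SG \<inter> C) x"
        proof (cases "x \<in> C")
          case True
          then show ?thesis
            using x by (simp add: f_def L.space_eq)
        next
          case False
          then have pos: "0 < infdist x C"
            using C in_closed_iff_infdist_zero[OF C] infdist_nonneg[of x C] by fastforce
          obtain N where N: "1 \<le> real N * infdist x C"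
            using reals_Archimedean3[OF pos] less_imp_le by blast
          have "f C n x = 0" if "n \<ge> N" for n
          proof -
            have "real N * infdist x C \<le> real n * infdist x C"
              using that pos by (intro mult_right_mono) auto
            then show ?thesis
              using N by (simp add: f_def)
          qed
          then have "\<forall>\<^sub>F n in sequentially. f C n x = 0"
            by (auto simp: eventually_sequentially)
          then show ?thesis
            using False by (simp add: tendsto_eventually)
        qed
      qed
    qed (use L.borel_Int_sets C in \<open>auto intro!: borel_measurable_indicator borel_closed\<close>)
    moreover have "(\<integral>x. indicator (SG \<inter> C) x \<partial>L) = measure L (SG \<inter> C)"
    proof -
      have "SG \<inter> C \<inter> SG = SG \<inter> C"
        by blast
      then show ?thesis
        by (simp add: L.space_eq)
    qed
    ultimately show ?thesis
      by simp
  qed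
  have closed_eq: "measure M (SG \<inter> C) = measure N (SG \<inter> C)" if C: "closed C" for C
  proof (cases "C = {}")
    case False
    have "(\<integral>x. f C n x \<partial>M) = (\<integral>x. f C n x \<partial>N)" for n
      unfolding f_def by (intro gasket_measure_integral_eq M N continuous_intros)
    then show ?thesis
      using lim[OF M C False] lim[OF N C False] LIMSEQ_unique by simp
  qed simp
  \<comment> \<open>Pushed forward to the whole plane, both measures live on the Borel sets, which
    the closed sets generate.\<close>
  have "distr M borel (\<lambda>x. x) = distr N borel (\<lambda>x. x)"
  proof (rule measure_eqI_generator_eq)
    show "Int_stable (Collect closed :: plane set set)"
      by (auto simp: Int_stable_def)
    show "emeasure (distr M borel (\<lambda>x. x)) C = emeasure (distr N borel (\<lambda>x. x)) C"
      if "C \<in> Collect closed" for C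
      using that closed_eq[of C] id
      by (simp add: emeasure_distr borel_closed M.space_eq N.space_eq M.emeasure_eq_measure
          N.emeasure_eq_measure Int_commute)
    show "emeasure (distr M borel (\<lambda>x. x)) UNIV \<noteq> \<infinity>"
      using id by (simp add: emeasure_distr M.emeasure_eq_measure)
  qed (auto simp: borel_eq_closed)
  then have "emeasure M A = emeasure N A" if A: "A \<in> sets M" for A
  proof -
    obtain B where B: "A = SG \<inter> B" "B \<in> sets borel"
      using A unfolding M.sets_eq sets_restrict_space by blast
    from \<open>distr M borel (\<lambda>x. x) = _\<close> have "emeasure (distr M borel (\<lambda>x. x)) B = emeasure (distr N borel (\<lambda>x. x)) B"
      by simp
    then show ?thesis
      using id B by (simp add: emeasure_distr M.space_eq N.space_eq Int_commute)
  qed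
  then show ?thesis
    by (intro measure_eqI) (simp_all add: M.sets_eq N.sets_eq)
qed

text \<open>The measure is the law of \<open>coding s\<close> for an address \<open>s\<close> of
  independent uniform letters. Conditioning on the first letter gives self-similarity, from which
  the masses of cells follow by induction once overlaps are known to be null.\<close>

lemma ex_gasket_measure: "\<exists>M. gasket_measure M"
proof -
  define D where "D = measure_pmf (pmf_of_set (UNIV :: 3 set))"
  interpret D: prob_space D
    unfolding D_def by (rule measure_pmf.prob_space_axioms)
  interpret S: prob_space "stream_space D"
    by (rule D.prob_space_stream_space)
  have sets_D: "sets D = UNIV"
    by (simp add: D_def)
  have "coding \<in> stream_space D \<rightarrow>\<^sub>M borel"
  proof -
    have "(\<lambda>s. sg_vertex (s !! n)) \<in> stream_space D \<rightarrow>\<^sub>M borel" for n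
      by (rule measurable_compose[OF measurable_snth]) (simp add: D_def)
    then show ?thesis
      unfolding coding_def[abs_def] by measurable
  qed
  then have meas [measurable]: "coding \<in> stream_space D \<rightarrow>\<^sub>M restrict_space borel SG"
    by (intro measurable_restrict_space2) (auto simp: coding_in_SG)
  define V where "V = distr (stream_space D) (restrict_space borel SG) coding"
  interpret V: prob_space V
    unfolding V_def by (rule S.prob_space_distr[OF meas])
  have sets_V: "sets V = sets (restrict_space borel SG)"
    by (simp add: V_def)
  have space_V: "space V = SG"
    using sets_eq_imp_space_eq[OF sets_V] by (simp add: space_restrict_space)
  have sets_V_compact: "C \<in> sets V" if "compact C" "C \<subseteq> SG" for C
    unfolding sets_V sets_restrict_space
    using that by (intro image_eqI[of _ _ C]) (auto simp: borel_compact)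
  have self_similar: "measure V C = (\<Sum>i\<in>UNIV. measure V {y \<in> SG. sg_map i y \<in> C}) / 3"
    if C: "compact C" "C \<subseteq> SG" for C
  proof -
    have "compact (SG \<inter> sg_map i -` C)" for i
      by (intro compact_Int_closed compact_SG closed_vimage compact_imp_closed C
          continuous_on_sg_map continuous_on_id)
    then have pre: "{y \<in> SG. sg_map i y \<in> C} \<in> sets V" for i
      by (intro sets_V_compact) (auto simp: vimage_def Int_def)
    have [measurable]: "coding -` C \<inter> space (stream_space D) \<in> sets (stream_space D)"
      using measurable_sets[OF meas] sets_V_compact[OF C] by (simp add: sets_V)
    have "emeasure V C = emeasure (stream_space D) (coding -` C \<inter> space (stream_space D))"
      unfolding V_def using sets_V_compact[OF C] by (intro emeasure_distr meas) (simp add: sets_V)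
    also have "\<dots> = (\<integral>\<^sup>+i. emeasure (stream_space D)
        {s \<in> space (stream_space D). i ## s \<in> coding -` C \<inter> space (stream_space D)} \<partial>D)"
      by (rule D.emeasure_stream_space) measurable
    also have "\<dots> = (\<integral>\<^sup>+i. emeasure V {y \<in> SG. sg_map i y \<in> C} \<partial>D)"
    proof (rule nn_integral_cong)
      fix i
      have "{s \<in> space (stream_space D). i ## s \<in> coding -` C \<inter> space (stream_space D)}
        = coding -` {y \<in> SG. sg_map i y \<in> C} \<inter> space (stream_space D)"
        by (auto simp: coding_Stream coding_in_SG space_stream_space D_def)
      then show "emeasure (stream_space D)
          {s \<in> space (stream_space D). i ## s \<in> coding -` C \<inter> space (stream_space D)}
        = emeasure V {y \<in> SG. sg_map i y \<in> C}"
        unfolding V_def using pre[of i] by (simp add: emeasure_distr[OF meas] sets_V)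
    qed
    also have "\<dots> = (\<Sum>i\<in>UNIV. emeasure V {y \<in> SG. sg_map i y \<in> C}) / 3"
      unfolding D_def by (subst nn_integral_pmf_of_set) auto
    also have "\<dots> = ennreal ((\<Sum>i\<in>UNIV. measure V {y \<in> SG. sg_map i y \<in> C}) / 3)"
      by (simp add: V.emeasure_eq_measure sum_ennreal ennreal_divide_numeral sum_nonneg)
    finally show ?thesis
      by (simp add: V.emeasure_eq_measure sum_nonneg)
  qed
  \<comment> \<open>Only \<open>sg_map i\<close> reaches the vertex of index \<open>i\<close>, and
    only from that vertex, so its mass is a third of itself.\<close>
  have vertex: "measure V {sg_vertex i} = 0" for i
  proof -
    have "{y \<in> SG. sg_map j y \<in> {sg_vertex i}} = (if j = i then {sg_vertex i} else {})" for j
      using sg_map_eq_vertex[of _ j i] sg_map_inject[of i _ "sg_vertex i"] by auto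
    then have pre: "measure V {y \<in> SG. sg_map j y \<in> {sg_vertex i}}
      = (if j = i then measure V {sg_vertex i} else 0)" for j
      by (simp only: measure_empty split: if_split) simp
    have "measure V {sg_vertex i} = (\<Sum>j\<in>UNIV. measure V {y \<in> SG. sg_map j y \<in> {sg_vertex i}}) / 3"
      by (rule self_similar) auto
    then show ?thesis
      unfolding pre by simp
  qed
  have "measure V (sg_cell w) = 1 / 3 ^ length w" for w
  proof (induction w)
    case Nil
    then show ?case
      using V.prob_space by (simp add: space_V)
  next
    case (Cons i w)
    have "measure V {y \<in> SG. sg_map j y \<in> sg_cell (i # w)}
      = (if j = i then measure V (sg_cell w) else 0)" for j
    proof (cases "j = i")
      case True
      then have "{y \<in> SG. sg_map j y \<in> sg_cell (i # w)} = sg_cell w"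
        using sg_cell_subset[of w] by (auto simp: sg_cell_Cons)
      with True show ?thesis
        by simp
    \<comment> \<open>A different map meets cell \<open>i\<close> at most in the junction point,
      whose preimage is a single vertex and hence null.\<close>
    next
      case False
      have "y = sg_vertex i" if "y \<in> SG" "z \<in> sg_cell w" "sg_map j y = sg_map i z" for y z
        using sg_map_eq_sg_map(1)[OF that(1) _ that(3) False] that(2) sg_cell_subset[of w] by auto
      then have "{y \<in> SG. sg_map j y \<in> sg_cell (i # w)} \<subseteq> {sg_vertex i}"
        by (auto simp: sg_cell_Cons)
      moreover have "{sg_vertex i} \<in> sets V"
        by (intro sets_V_compact) auto
      ultimately have "measure V {y \<in> SG. sg_map j y \<in> sg_cell (i # w)} \<le> measure V {sg_vertex i}"
        by (intro V.finite_measure_mono)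
      with False show ?thesis
        by (simp add: vertex measure_le_0_iff)
    qed
    then have "measure V (sg_cell (i # w)) = measure V (sg_cell w) / 3"
      by (subst self_similar[OF compact_sg_cell sg_cell_subset]) simp
    with Cons show ?case
      by simp
  qed
  then have "gasket_measure V"
    by unfold_locales (rule sets_V)
  then show ?thesis
    by blast
qed

global_interpretation sg: gasket_measure sg_measure
proof -
  have "prob_space M \<and> sets M = sets (restrict_space borel SG) \<and>
     (\<forall>w. measure M (sg_cell w) = 1 / 3 ^ length w) \<longleftrightarrow> gasket_measure M" for M
    by (auto simp: gasket_measure_def gasket_measure_axioms_def)
  then have "sg_measure = (THE M. gasket_measure M)"
    unfolding sg_measure_def by simp
  also have "gasket_measure \<dots>"
    by (rule theI') (use ex_gasket_measure gasket_measure_unique in blast)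
  finally show "gasket_measure sg_measure" .
qed

text \<open>The image measure gives the same masses to cells, as reflection preserves the length of
  words.\<close>

lemma distr_sg_reflect: "distr sg_measure sg_measure sg_reflect = sg_measure"
proof (rule gasket_measure_unique[OF _ sg.gasket_measure_axioms])
  have meas: "sg_reflect \<in> sg_measure \<rightarrow>\<^sub>M sg_measure"
  proof -
    have "sg_reflect \<in> sg_measure \<rightarrow>\<^sub>M restrict_space borel SG"
      by (intro measurable_restrict_space2 sg.continuous_measurable continuous_on_sg_reflect)
        (auto simp: sg.space_eq)
    then show ?thesis
      using measurable_cong_sets[OF refl sg.sets_eq] by blast
  qed
  show "gasket_measure (distr sg_measure sg_measure sg_reflect)"
  proof (intro gasket_measure.intro gasket_measure_axioms.intro sg.prob_space_distr meas)
    show "sets (distr sg_measure sg_measure sg_reflect) = sets (restrict_space borel SG)"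
      by (simp add: sg.sets_eq)
    fix w
    have "sg_reflect -` sg_cell w \<inter> space sg_measure = sg_cell (map uminus w)"
      using sg_cell_subset[of "map uminus w"] by (auto simp: sg_reflect_in_cell_iff sg.space_eq)
    then show "measure (distr sg_measure sg_measure sg_reflect) (sg_cell w) = 1 / 3 ^ length w"
      by (simp add: measure_distr[OF meas] sg.measure_cell)
  qed
qed

lemma integral_sg_reflect:
  fixes f :: "plane \<Rightarrow> real"
  assumes "continuous_on SG f"
  shows "(\<integral>x. f (sg_reflect x) \<partial>sg_measure) = (\<integral>x. f x \<partial>sg_measure)"
proof -
  have "sg_reflect \<in> sg_measure \<rightarrow>\<^sub>M restrict_space borel SG"
    by (intro measurable_restrict_space2 sg.continuous_measurable continuous_on_sg_reflect)
      (auto simp: sg.space_eq)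
  then have "sg_reflect \<in> sg_measure \<rightarrow>\<^sub>M sg_measure"
    using measurable_cong_sets[OF refl sg.sets_eq] by blast
  from integral_distr[OF this sg.continuous_measurable[OF assms]] show ?thesis
    by (simp add: distr_sg_reflect)
qed

section \<open>Graph energies\<close>

lemma sg_vertices_subset: "sg_vertices m \<subseteq> SG"
  by (auto simp: sg_vertices_def sg_boundary_def)

lemma finite_sg_vertices: "finite (sg_vertices m)"
  by (simp add: sg_vertices_def sg_boundary_def finite_words)

lemma sg_vertices_0: "sg_vertices 0 = sg_boundary"
  by (simp add: sg_vertices_def)

lemma sg_vertices_Suc: "sg_vertices (Suc m) = (\<Union>i. sg_map i ` sg_vertices m)"
proof -
  have "{w. length w = Suc m} = (\<Union>i :: 3. (#) i ` {w. length w = m})"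
    by (auto simp: length_Suc_conv)
  then show ?thesis
    unfolding sg_vertices_def by (simp add: image_comp image_UN) blast
qed

lemma sg_vertex_in_vertices: "sg_vertex i \<in> sg_vertices m"
proof (induction m)
  case (Suc m)
  then have "sg_map i (sg_vertex i) \<in> sg_vertices (Suc m)"
    unfolding sg_vertices_Suc by blast
  then show ?case
    by simp
qed (simp add: sg_vertices_0 sg_boundary_def)

lemma sg_adjacent_0: "sg_adjacent 0 x y \<longleftrightarrow> x \<in> sg_boundary \<and> y \<in> sg_boundary \<and> x \<noteq> y"
  by (auto simp: sg_adjacent_def sg_vertices_0 sg_boundary_def)

text \<open>The point may be known as a vertex only through another cell \<open>j\<close>. It is
  then a junction point, its preimage is a corner, and corners are vertices of every level.\<close>

lemma sg_map_in_vertices: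
  assumes "x \<in> SG" "sg_map i x \<in> sg_vertices (Suc m)"
  shows "x \<in> sg_vertices m"
proof -
  obtain j y where y: "y \<in> sg_vertices m" "sg_map i x = sg_map j y"
    using assms(2) unfolding sg_vertices_Suc by blast
  show ?thesis
  proof (cases "i = j")
    case True
    with y show ?thesis
      by simp
  next
    case False
    then have "x = sg_vertex j"
      using sg_map_eq_sg_map(1)[OF assms(1) _ y(2)] y(1) sg_vertices_subset by blast
    then show ?thesis
      by (simp add: sg_vertex_in_vertices)
  qed
qed

lemma sg_adjacent_Suc:
  "sg_adjacent (Suc m) x y \<longleftrightarrow> (\<exists>i x' y'. x = sg_map i x' \<and> y = sg_map i y' \<and> sg_adjacent m x' y')"
proof
  assume adj: "sg_adjacent (Suc m) x y"
  then obtain w where w: "length w = Suc m" "x \<in> sg_cell w" "y \<in> sg_cell w"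
    unfolding sg_adjacent_def by blast
  then obtain i v where v: "w = i # v" "length v = m"
    by (auto simp: length_Suc_conv)
  obtain x' y' where xy: "x = sg_map i x'" "y = sg_map i y'" "x' \<in> sg_cell v" "y' \<in> sg_cell v"
    using w(2,3) unfolding v(1) sg_cell_Cons by blast
  moreover have "x' \<in> sg_vertices m" "y' \<in> sg_vertices m"
    using adj xy sg_cell_subset[of v] sg_map_in_vertices unfolding sg_adjacent_def by blast+
  moreover have "x' \<noteq> y'"
    using adj xy unfolding sg_adjacent_def by blast
  ultimately show "\<exists>i x' y'. x = sg_map i x' \<and> y = sg_map i y' \<and> sg_adjacent m x' y'"
    using v(2) unfolding sg_adjacent_def by blast
next
  assume "\<exists>i x' y'. x = sg_map i x' \<and> y = sg_map i y' \<and> sg_adjacent m x' y'"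
  then obtain i x' y' w where "x = sg_map i x'" "y = sg_map i y'" "x' \<in> sg_vertices m"
    "y' \<in> sg_vertices m" "x' \<noteq> y'" "length w = m" "x' \<in> sg_cell w" "y' \<in> sg_cell w"
    unfolding sg_adjacent_def by blast
  then show "sg_adjacent (Suc m) x y"
    unfolding sg_adjacent_def sg_vertices_Suc
    by (auto simp: sg_cell_Cons intro!: exI[of _ "i # w"])
qed

lemma sg_adjacent_in_SG: "sg_adjacent m x y \<Longrightarrow> x \<in> SG \<and> y \<in> SG"
  using sg_vertices_subset unfolding sg_adjacent_def by blast

lemma finite_sg_adjacent: "finite {(x, y). sg_adjacent m x y}"
  by (rule finite_subset[of _ "sg_vertices m \<times> sg_vertices m"])
    (auto simp: sg_adjacent_def finite_sg_vertices)

definition triangle_energy :: "(3 \<Rightarrow> real) \<Rightarrow> (3 \<Rightarrow> real) \<Rightarrow> real" where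
  "triangle_energy a b = (a 0 - a 1) * (b 0 - b 1) + (a 1 - a 2) * (b 1 - b 2) + (a 2 - a 0) * (b 2 - b 0)"

lemma graph_energy_0: "graph_energy 0 u v = triangle_energy (\<lambda>i. u (sg_vertex i)) (\<lambda>i. v (sg_vertex i))"
proof -
  have ne: "sg_vertex i = sg_vertex j \<longleftrightarrow> i = j" for i j
    using inj_sg_vertex by (auto dest: injD)
  have "{(x, y). sg_adjacent 0 x y} = (\<lambda>(i, j). (sg_vertex i, sg_vertex j)) `
      {(0, 1), (1, 0), (1, 2), (2, 1), (2, 0), (0, 2)}"
    unfolding sg_adjacent_0 sg_boundary_def UNIV_mod3 by (auto simp: ne)
  moreover have "inj_on (\<lambda>(i, j). (sg_vertex i, sg_vertex j))
      {(0, 1), (1, 0), (1, 2), (2, 1), (2, 0), (0, 2)}"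
    by (auto simp: inj_on_def ne)
  ultimately show ?thesis
    by (simp add: graph_energy_def triangle_energy_def ne algebra_simps)
qed

text \<open>Edges of level \<open>Suc m\<close> are images of edges of level \<open>m\<close> under
  exactly one of the three maps: different cells share a single point and so no edge. This recursion
  replaces direct work with edge sets in all later energy computations.\<close>

lemma graph_energy_Suc:
  "graph_energy (Suc m) u v =
    5 / 3 * (\<Sum>i\<in>UNIV. graph_energy m (\<lambda>x. u (sg_map i x)) (\<lambda>x. v (sg_map i x)))"
proof -
  let ?A = "{(x, y). sg_adjacent m x y}"
  let ?f = "\<lambda>(x, y). (u x - u y) * (v x - v y)"
  let ?F = "\<lambda>i. map_prod (sg_map i) (sg_map i)"
  have "{(x, y). sg_adjacent (Suc m) x y} = (\<Union>i. ?F i ` ?A)"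
    unfolding sg_adjacent_Suc by force
  then have "(\<Sum>p\<in>{(x, y). sg_adjacent (Suc m) x y}. ?f p) = (\<Sum>p\<in>(\<Union>i. ?F i ` ?A). ?f p)"
    by (rule arg_cong)
  also have "\<dots> = (\<Sum>i\<in>UNIV. \<Sum>p\<in>?F i ` ?A. ?f p)"
  proof (rule sum.UNION_disjoint)
    have "False" if "sg_adjacent m x y" "sg_adjacent m x' y'" "i \<noteq> j" 
      "sg_map i x = sg_map j x'" "sg_map i y = sg_map j y'" for i j x y x' y'
      using that sg_map_eq_sg_map(1)[of x x' i j] sg_map_eq_sg_map(1)[of y y' i j]
        sg_adjacent_in_SG[of m x y] sg_adjacent_in_SG[of m x' y']
      by (auto simp: sg_adjacent_def)
    then show "\<forall>i\<in>UNIV. \<forall>j\<in>UNIV. i \<noteq> j \<longrightarrow> ?F i ` ?A \<inter> ?F j ` ?A = {}"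
      by (auto simp: disjoint_iff)
  qed (simp_all add: finite_sg_adjacent)
  also have "\<dots> = (\<Sum>i\<in>UNIV. \<Sum>p\<in>?A. ?f (?F i p))"
  proof (rule sum.cong[OF refl])
    fix i
    have "inj_on (?F i) ?A"
      using prod.inj_map[OF inj_sg_map inj_sg_map] by (rule inj_on_subset) simp
    then show "(\<Sum>p\<in>?F i ` ?A. ?f p) = (\<Sum>p\<in>?A. ?f (?F i p))"
      by (simp only: sum.reindex comp_def)
  qed
  also have "\<dots> = (\<Sum>i\<in>UNIV. \<Sum>(x, y)\<in>?A.
      (u (sg_map i x) - u (sg_map i y)) * (v (sg_map i x) - v (sg_map i y)))"
    by (simp add: case_prod_unfold)
  finally have "(\<Sum>p\<in>{(x, y). sg_adjacent (Suc m) x y}. ?f p) = \<dots>" .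
  then show ?thesis
    unfolding graph_energy_def sum_distrib_left[symmetric] by simp
qed

lemma graph_energy_cong:
  assumes "\<And>x. x \<in> SG \<Longrightarrow> u x = u' x" "\<And>x. x \<in> SG \<Longrightarrow> v x = v' x"
  shows "graph_energy m u v = graph_energy m u' v'"
  unfolding graph_energy_def using assms sg_adjacent_in_SG
  by (intro arg_cong2[of _ _ _ _ "(*)"] refl sum.cong) auto

lemma graph_energy_commute: "graph_energy m u v = graph_energy m v u"
  by (simp add: graph_energy_def mult.commute)

lemma graph_energy_add_left:
  "graph_energy m (\<lambda>x. u x + u' x) v = graph_energy m u v + graph_energy m u' v"
  unfolding graph_energy_def
  by (simp add: algebra_simps case_prod_unfold sum.distrib sum_subtractf)

lemma graph_energy_scale_left: "graph_energy m (\<lambda>x. c * u x) v = c * graph_energy m u v"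
  unfolding graph_energy_def
  by (simp add: sum_distrib_left case_prod_unfold algebra_simps)

lemma graph_energy_nonneg: "0 \<le> graph_energy m u u"
  unfolding graph_energy_def by (intro mult_nonneg_nonneg sum_nonneg) auto

lemma graph_energy_add_add:
  "graph_energy m (\<lambda>x. u x + v x) (\<lambda>x. u x + v x)
    = graph_energy m u u + 2 * graph_energy m u v + graph_energy m v v"
  unfolding graph_energy_add_left[of m u v "\<lambda>x. u x + v x"]
    graph_energy_commute[of m u "\<lambda>x. u x + v x"] graph_energy_commute[of m v "\<lambda>x. u x + v x"]
    graph_energy_add_left
  using graph_energy_commute[of m v u] by linarith

lemma graph_energy_scale_scale:
  "graph_energy m (\<lambda>x. c * u x) (\<lambda>x. c * u x) = c\<^sup>2 * graph_energy m u u"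
  unfolding graph_energy_scale_left[of m c u "\<lambda>x. c * u x"]
    graph_energy_commute[of m u "\<lambda>x. c * u x"] graph_energy_scale_left
  by (simp add: power2_eq_square)

text \<open>The factor 5/3 is chosen so that the cheapest extension to the next level keeps the
  energy; any other extension costs more. Only the base case needs computation, the rest is
  self-similarity.\<close>

lemma graph_energy_le_Suc: "graph_energy m u u \<le> graph_energy (Suc m) u u"
proof (induction m arbitrary: u)
  case 0
  define a b c where "a = u (sg_vertex 0)" and "b = u (sg_vertex 1)" and "c = u (sg_vertex 2)"
  define x y z where "x = u (sg_map 0 (sg_vertex 1))" and "y = u (sg_map 1 (sg_vertex 2))"
    and "z = u (sg_map 2 (sg_vertex 0))"
  \<comment> \<open>Five times the deviations of the midpoint values from the 2/5 - 2/5 - 1/5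
    extension. The gain is the level 1 energy of the deviation, which vanishes at the corners; the
    denominator 15 comes from 5/3 times 1/25.\<close>
  define p q r where "p = 5 * x - (2 * a + 2 * b + c)" and "q = 5 * y - (2 * b + 2 * c + a)"
    and "r = 5 * z - (2 * c + 2 * a + b)"
  have "graph_energy (Suc 0) u u - graph_energy 0 u u
    = (2 * p\<^sup>2 + 2 * q\<^sup>2 + 2 * r\<^sup>2 + (p - q)\<^sup>2 + (q - r)\<^sup>2 + (r - p)\<^sup>2) / 15"
    unfolding graph_energy_Suc graph_energy_0 triangle_energy_def sum_mod3 sg_map_vertex
      sg_map_vertex_commute[of 1 0] sg_map_vertex_commute[of 2 1] sg_map_vertex_commute[of 0 2]
      a_def[symmetric] b_def[symmetric] c_def[symmetric] x_def[symmetric] y_def[symmetric] z_def[symmetric]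
      p_def q_def r_def
    by (simp add: power2_eq_square field_simps)
  also have "0 \<le> \<dots>"
    by simp
  finally show ?case
    by simp
next
  case (Suc m)
  show ?case
    unfolding graph_energy_Suc[of "Suc m"] graph_energy_Suc[of m]
    by (intro mult_left_mono sum_mono Suc[unfolded graph_energy_Suc]) simp
qed

section \<open>Functions of finite energy and the bilinear energy form\<close>

lemma incseq_graph_energy: "incseq (\<lambda>m. graph_energy m u u)"
  by (rule incseq_SucI) (rule graph_energy_le_Suc)

lemma energy_domainI:
  assumes "continuous_on SG u" "\<And>m. graph_energy m u u \<le> B"
  shows "u \<in> energy_domain"
  using incseq_convergent[OF incseq_graph_energy] assms
  unfolding energy_domain_def convergent_def by blast

lemma energy_domain_continuous: "u \<in> energy_domain \<Longrightarrow> continuous_on SG u"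
  by (simp add: energy_domain_def)

lemma energy_domain_bounded:
  assumes "u \<in> energy_domain"
  obtains B where "\<And>m. graph_energy m u u \<le> B"
proof -
  obtain L where "(\<lambda>m. graph_energy m u u) \<longlonglongrightarrow> L"
    using assms by (auto simp: energy_domain_def convergent_def)
  then show ?thesis
    using incseq_le[OF incseq_graph_energy] by (intro that[of L])
qed

lemma energy_domain_cong:
  assumes "\<And>x. x \<in> SG \<Longrightarrow> u x = u' x"
  shows "u \<in> energy_domain \<longleftrightarrow> u' \<in> energy_domain"
proof -
  have "graph_energy m u u = graph_energy m u' u'" for m
    by (rule graph_energy_cong[OF assms assms])
  moreover have "continuous_on SG u \<longleftrightarrow> continuous_on SG u'"
    by (rule continuous_on_cong[OF refl assms])
  ultimately show ?thesis
    unfolding energy_domain_def by simp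
qed

lemma energy_domain_scale:
  assumes "u \<in> energy_domain"
  shows "(\<lambda>x. c * u x) \<in> energy_domain"
proof -
  obtain B where B: "\<And>m. graph_energy m u u \<le> B"
    using energy_domain_bounded[OF assms] by blast
  have "graph_energy m (\<lambda>x. c * u x) (\<lambda>x. c * u x) \<le> c\<^sup>2 * B" for m
    unfolding graph_energy_scale_scale by (intro mult_left_mono B) simp
  then show ?thesis
    using energy_domain_continuous[OF assms]
    by (intro energy_domainI[of _ "c\<^sup>2 * B"] continuous_on_mult continuous_on_const)
qed

lemma energy_domain_add:
  assumes "u \<in> energy_domain" "v \<in> energy_domain"
  shows "(\<lambda>x. u x + v x) \<in> energy_domain"
proof -
  obtain A where A: "\<And>m. graph_energy m u u \<le> A"
    using energy_domain_bounded[OF assms(1)] by blast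
  obtain B where B: "\<And>m. graph_energy m v v \<le> B"
    using energy_domain_bounded[OF assms(2)] by blast
  \<comment> \<open>The energy of the difference of \<open>u\<close> and \<open>v\<close> is
    nonnegative, which bounds the mixed term by the two diagonal ones.\<close>
  have "graph_energy m (\<lambda>x. u x + v x) (\<lambda>x. u x + v x) \<le> 2 * A + 2 * B" for m
  proof -
    have "0 \<le> graph_energy m (\<lambda>x. u x + (- 1) * v x) (\<lambda>x. u x + (- 1) * v x)"
      by (rule graph_energy_nonneg)
    also have "\<dots> = graph_energy m u u - 2 * graph_energy m u v + graph_energy m v v"
      unfolding graph_energy_add_add graph_energy_scale_scale
      using graph_energy_scale_left[of m "- 1" v u] graph_energy_commute[of m u v]
        graph_energy_commute[of m u "\<lambda>x. - 1 * v x"] by simp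
    finally show ?thesis
      using A[of m] B[of m] unfolding graph_energy_add_add by linarith
  qed
  then show ?thesis
    using energy_domain_continuous[OF assms(1)] energy_domain_continuous[OF assms(2)]
    by (intro energy_domainI[of _ "2 * A + 2 * B"] continuous_on_add)
qed

text \<open>Membership in \<open>energy_domain\<close> gives convergence on the diagonal only;
  polarization transfers it to mixed energies.\<close>

lemma graph_energy_tendsto_energy:
  assumes "u \<in> energy_domain" "v \<in> energy_domain"
  shows "(\<lambda>m. graph_energy m u v) \<longlonglongrightarrow> energy u v"
proof -
  have conv: "(\<lambda>m. graph_energy m w w) \<longlonglongrightarrow> energy w w" if "w \<in> energy_domain" for w
    using that by (simp add: energy_domain_def energy_def convergent_LIMSEQ_iff)
  have "(\<lambda>m. (graph_energy m (\<lambda>x. u x + v x) (\<lambda>x. u x + v x)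
      - graph_energy m u u - graph_energy m v v) / 2)
    \<longlonglongrightarrow> (energy (\<lambda>x. u x + v x) (\<lambda>x. u x + v x) - energy u u - energy v v) / 2"
    by (intro tendsto_divide tendsto_diff tendsto_const conv energy_domain_add assms) simp
  moreover have "(graph_energy m (\<lambda>x. u x + v x) (\<lambda>x. u x + v x)
      - graph_energy m u u - graph_energy m v v) / 2 = graph_energy m u v" for m
    unfolding graph_energy_add_add by simp
  ultimately have "convergent (\<lambda>m. graph_energy m u v)"
    by (auto simp: convergent_def)
  then show ?thesis
    by (simp add: energy_def convergent_LIMSEQ_iff)
qed

lemma energy_add_left:
  assumes "u \<in> energy_domain" "u' \<in> energy_domain" "v \<in> energy_domain"
  shows "energy (\<lambda>x. u x + u' x) v = energy u v + energy u' v"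
proof (rule LIMSEQ_unique)
  show "(\<lambda>m. graph_energy m (\<lambda>x. u x + u' x) v) \<longlonglongrightarrow> energy (\<lambda>x. u x + u' x) v"
    by (intro graph_energy_tendsto_energy energy_domain_add assms)
  show "(\<lambda>m. graph_energy m (\<lambda>x. u x + u' x) v) \<longlonglongrightarrow> energy u v + energy u' v"
    unfolding graph_energy_add_left by (intro tendsto_add graph_energy_tendsto_energy assms)
qed

lemma energy_scale_left:
  assumes "u \<in> energy_domain" "v \<in> energy_domain"
  shows "energy (\<lambda>x. c * u x) v = c * energy u v"
proof (rule LIMSEQ_unique)
  show "(\<lambda>m. graph_energy m (\<lambda>x. c * u x) v) \<longlonglongrightarrow> energy (\<lambda>x. c * u x) v"
    by (intro graph_energy_tendsto_energy energy_domain_scale assms)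
  show "(\<lambda>m. graph_energy m (\<lambda>x. c * u x) v) \<longlonglongrightarrow> c * energy u v"
    unfolding graph_energy_scale_left by (intro tendsto_mult_left graph_energy_tendsto_energy assms)
qed

lemma energy_cong:
  assumes "\<And>x. x \<in> SG \<Longrightarrow> u x = u' x" "\<And>x. x \<in> SG \<Longrightarrow> v x = v' x"
  shows "energy u v = energy u' v'"
  unfolding energy_def using graph_energy_cong[OF assms] by simp

lemma graph_energy_reflect:
  "graph_energy m (\<lambda>x. u (sg_reflect x)) (\<lambda>x. v (sg_reflect x)) = graph_energy m u v"
proof (induction m arbitrary: u v)
  case 0
  show ?case
    unfolding graph_energy_0 triangle_energy_def by (simp add: algebra_simps)
next
  case (Suc m)
  have "graph_energy m (\<lambda>x. u (sg_reflect (sg_map i x))) (\<lambda>x. v (sg_reflect (sg_map i x)))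
      = graph_energy m (\<lambda>x. u (sg_map (- i) x)) (\<lambda>x. v (sg_map (- i) x))" for i
    using Suc[of "\<lambda>x. u (sg_map (- i) x)" "\<lambda>x. v (sg_map (- i) x)"] by (simp add: sg_reflect_map)
  then show ?case
    unfolding graph_energy_Suc sum_mod3 by simp
qed

lemma energy_reflect: "energy (\<lambda>x. u (sg_reflect x)) (\<lambda>x. v (sg_reflect x)) = energy u v"
  unfolding energy_def graph_energy_reflect ..

lemma continuous_reflect: "continuous_on SG f \<Longrightarrow> continuous_on SG (\<lambda>x. f (sg_reflect x))"
  using continuous_on_compose2[OF _ continuous_on_sg_reflect, of SG f SG] sg_reflect_SG by auto

lemma energy_domain_reflect: "u \<in> energy_domain \<Longrightarrow> (\<lambda>x. u (sg_reflect x)) \<in> energy_domain"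
  unfolding energy_domain_def by (simp add: graph_energy_reflect continuous_reflect)

section \<open>Harmonic functions and bumps\<close>

text \<open>Assembles a function from its pullbacks \<open>f i\<close> to the cells of level 1. A
  junction point lies in two cells, and \<open>compatible\<close> says that both prescribe the same
  value there, so the order of the tests is immaterial.\<close>

definition glue :: "(3 \<Rightarrow> plane \<Rightarrow> real) \<Rightarrow> plane \<Rightarrow> real" where
  "glue f x = (let i = (if x \<in> sg_map 0 ` SG then 0 else if x \<in> sg_map 1 ` SG then 1 else 2)
     in f i (sg_map_inv i x))"

definition compatible :: "(3 \<Rightarrow> plane \<Rightarrow> real) \<Rightarrow> bool" where
  "compatible f \<longleftrightarrow> (\<forall>i j. f i (sg_vertex j) = f j (sg_vertex i))"

lemma glue_map:
  assumes f: "compatible f" and x: "x \<in> SG"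
  shows "glue f (sg_map i x) = f i x"
proof -
  have eq: "f j (sg_map_inv j (sg_map i x)) = f i x" if j: "sg_map i x \<in> sg_map j ` SG" for j
  proof (cases "j = i")
    case False
    obtain y where y: "y \<in> SG" "sg_map i x = sg_map j y"
      using j by blast
    have "x = sg_vertex j" "y = sg_vertex i"
      using sg_map_eq_sg_map[OF x y] False by auto
    then show ?thesis
      using f y by (simp add: compatible_def)
  qed simp
  have "sg_map i x \<in> sg_map 0 ` SG \<or> sg_map i x \<in> sg_map 1 ` SG \<or> sg_map i x \<in> sg_map 2 ` SG"
    using x by (cases i rule: mod3_cases) auto
  then show ?thesis
    unfolding glue_def Let_def using eq by auto
qed

lemma continuous_on_glue:
  assumes f: "compatible f" and cont: "\<And>i. continuous_on SG (f i)"
  shows "continuous_on SG (glue f)"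
proof -
  have "continuous_on (sg_map i ` SG) (glue f)" for i
  proof -
    have "continuous_on (sg_map i ` SG) (\<lambda>x. f i (sg_map_inv i x))"
      by (rule continuous_on_compose2[OF cont continuous_on_sg_map_inv]) auto
    moreover have "f i (sg_map_inv i x) = glue f x" if "x \<in> sg_map i ` SG" for x
      using glue_map[OF f] that by auto
    ultimately show ?thesis
      using continuous_on_cong[of "sg_map i ` SG" "sg_map i ` SG" "\<lambda>x. f i (sg_map_inv i x)" "glue f"]
      by blast
  qed
  moreover have "closed (sg_map i ` SG)" for i
    by (intro compact_imp_closed compact_continuous_image compact_SG continuous_on_sg_map continuous_on_id)
  ultimately have "continuous_on (\<Union>i. sg_map i ` SG) (glue f)"
    by (intro continuous_on_closed_Union) auto
  then show ?thesis
    by (subst SG_eq)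
qed

lemma glue_vertex: "compatible f \<Longrightarrow> glue f (sg_vertex i) = f i (sg_vertex i)"
  using glue_map[of f "sg_vertex i" i] by simp

lemma graph_energy_glue:
  assumes "compatible f"
  shows "graph_energy (Suc m) (glue f) (glue f) = 5 / 3 * (\<Sum>i\<in>UNIV. graph_energy m (f i) (f i))"
  unfolding graph_energy_Suc
  by (intro arg_cong2[of _ _ _ _ "(*)"] refl sum.cong graph_energy_cong glue_map assms)

text \<open>The boundary values on the cell of index \<open>i\<close> of the harmonic function with boundary values
  \<open>a\<close>; off the diagonal this is the 2/5 - 2/5 - 1/5 rule.\<close>

definition harmonic_step :: "3 \<Rightarrow> (3 \<Rightarrow> real) \<Rightarrow> 3 \<Rightarrow> real" where
  "harmonic_step i a j = (if j = i then a i else (a i + a j + (\<Sum>k\<in>UNIV. a k)) / 5)"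

lemma harmonic_step_commute: "harmonic_step i a j = harmonic_step j a i"
  by (simp add: harmonic_step_def)

text \<open>The \<open>n\<close>-th approximation is harmonic on the vertices of level \<open>n\<close> and affine in between.\<close>

primrec harmonic_approx :: "nat \<Rightarrow> (3 \<Rightarrow> real) \<Rightarrow> plane \<Rightarrow> real" where
  "harmonic_approx 0 a = (\<lambda>x. \<Sum>i\<in>UNIV. a i * bary i x)"
| "harmonic_approx (Suc n) a = glue (\<lambda>i. harmonic_approx n (harmonic_step i a))"

text \<open>The claims are coupled: vertex values of a glued function can be read off only if the
  pieces are compatible, and compatibility follows from the vertex values and the symmetry of
  \<open>harmonic_step\<close>.\<close>

lemma harmonic_approx_vertex_compatible:
  "harmonic_approx n a (sg_vertex i) = a i \<and>
   compatible (\<lambda>i. harmonic_approx n (harmonic_step i a))"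
proof (induction n arbitrary: a i)
  case 0
  have "harmonic_approx 0 a (sg_vertex i) = a i" for a i
    by (cases i rule: mod3_cases) (simp_all add: bary_vertex sum_mod3)
  then show ?case
    using harmonic_step_commute by (simp add: compatible_def)
next
  case (Suc n)
  have "harmonic_approx (Suc n) a (sg_vertex i) = a i" for a i
  proof -
    have "harmonic_approx (Suc n) a (sg_vertex i) = harmonic_approx n (harmonic_step i a) (sg_vertex i)"
      using Suc by (simp add: glue_vertex)
    then show ?thesis
      using Suc[of "harmonic_step i a" i] by (simp add: harmonic_step_def)
  qed
  then show ?case
    using harmonic_step_commute by (simp add: compatible_def del: harmonic_approx.simps)
qed

lemmas harmonic_approx_vertex = harmonic_approx_vertex_compatible[THEN conjunct1]
  and harmonic_approx_compatible = harmonic_approx_vertex_compatible[THEN conjunct2]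

lemma harmonic_approx_map:
  "x \<in> SG \<Longrightarrow> harmonic_approx (Suc n) a (sg_map i x) = harmonic_approx n (harmonic_step i a) x"
  by (simp add: glue_map harmonic_approx_compatible)

lemma continuous_on_harmonic_approx: "continuous_on SG (harmonic_approx n a)"
proof (induction n arbitrary: a)
  case 0
  show ?case
    by (simp, intro continuous_intros continuous_on_bary)
next
  case (Suc n)
  then show ?case
    by (simp add: continuous_on_glue harmonic_approx_compatible)
qed

text \<open>Passing to a subcell shrinks the oscillation of the boundary values by 3/5. This
  geometric decay makes the approximations converge uniformly.\<close>

lemma harmonic_step_osc:
  assumes "\<And>i j. \<bar>a i - a j\<bar> \<le> D"
  shows "\<bar>a i - harmonic_step i a j\<bar> \<le> D" "\<bar>harmonic_step k a i - harmonic_step k a j\<bar> \<le> 3 / 5 * D"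
proof -
  note D = assms[of 0 1] assms[of 1 2] assms[of 2 0]
  show "\<bar>a i - harmonic_step i a j\<bar> \<le> D" "\<bar>harmonic_step k a i - harmonic_step k a j\<bar> \<le> 3 / 5 * D"
    using D unfolding abs_le_iff
    by (cases i rule: mod3_cases; cases j rule: mod3_cases; cases k rule: mod3_cases;
        simp add: harmonic_step_def sum_mod3 field_simps)+
qed

lemma convex_combination_diff_le:
  assumes x: "x \<in> SG" and c: "\<And>j. \<bar>c j - d\<bar> \<le> D"
  shows "\<bar>(\<Sum>j\<in>UNIV. c j * bary j x) - d\<bar> \<le> D"
proof -
  have "(\<Sum>j\<in>UNIV. c j * bary j x) - d = (\<Sum>j\<in>UNIV. (c j - d) * bary j x)"
    using sum_bary[of x] by (simp add: left_diff_distrib sum_subtractf flip: sum_distrib_left)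
  also have "\<bar>\<dots>\<bar> \<le> (\<Sum>j\<in>UNIV. \<bar>c j - d\<bar> * bary j x)"
    using sum_abs[of "\<lambda>j. (c j - d) * bary j x" UNIV] bary_nonneg[OF x] by (simp add: abs_mult)
  also have "\<dots> \<le> (\<Sum>j\<in>UNIV. D * bary j x)"
    by (intro sum_mono mult_right_mono c bary_nonneg x)
  also have "\<dots> = D"
    by (simp add: sum_bary flip: sum_distrib_left)
  finally show ?thesis .
qed

text \<open>On a cell, the difference of consecutive approximations is the previous difference for
  boundary values of oscillation at most \<open>3 / 5 * D\<close>. At level 0 both functions stay
  within \<open>D\<close> of the corner value \<open>a i\<close>, whence the factor 2.\<close>

lemma harmonic_approx_diff:
  assumes "x \<in> SG" "\<And>i j. \<bar>a i - a j\<bar> \<le> D"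
  shows "\<bar>harmonic_approx (Suc n) a x - harmonic_approx n a x\<bar> \<le> 2 * D * (3 / 5) ^ n"
  using assms
proof (induction n arbitrary: a x D)
  case 0
  obtain i y where y: "y \<in> SG" "x = sg_map i y"
    using SG_cases[OF 0(1)] .
  have "harmonic_approx (Suc 0) a x = (\<Sum>j\<in>UNIV. harmonic_step i a j * bary j y)"
    unfolding y(2) harmonic_approx_map[OF y(1)] by simp
  moreover have "\<bar>(\<Sum>j\<in>UNIV. harmonic_step i a j * bary j y) - a i\<bar> \<le> D"
    using harmonic_step_osc(1)[OF 0(2)] by (intro convex_combination_diff_le y) (simp add: abs_minus_commute)
  moreover have "\<bar>harmonic_approx 0 a x - a i\<bar> \<le> D"
    unfolding harmonic_approx.simps by (intro convex_combination_diff_le 0)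
  ultimately show ?case
    by simp
next
  case (Suc n)
  obtain i y where y: "y \<in> SG" "x = sg_map i y"
    using SG_cases[OF Suc(2)] .
  have "\<bar>harmonic_approx (Suc n) (harmonic_step i a) y - harmonic_approx n (harmonic_step i a) y\<bar>
      \<le> 2 * (3 / 5 * D) * (3 / 5) ^ n"
    by (intro Suc(1) y harmonic_step_osc(2) Suc(3))
  then show ?case
    unfolding y(2) harmonic_approx_map[OF y(1)] by simp
qed

definition harmonic :: "(3 \<Rightarrow> real) \<Rightarrow> plane \<Rightarrow> real" where
  "harmonic a x = lim (\<lambda>n. harmonic_approx n a x)"

lemma uniform_limit_harmonic: "uniform_limit SG (\<lambda>n. harmonic_approx n a) (harmonic a) sequentially"
proof -
  define D where "D = \<bar>a 0 - a 1\<bar> + \<bar>a 1 - a 2\<bar> + \<bar>a 2 - a 0\<bar>"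
  have D: "\<bar>a i - a j\<bar> \<le> D" for i j
    by (cases i rule: mod3_cases; cases j rule: mod3_cases) (auto simp: D_def)
  let ?f = "\<lambda>n x. harmonic_approx (Suc n) a x - harmonic_approx n a x"
  have "uniform_limit SG (\<lambda>n x. \<Sum>i<n. ?f i x) (\<lambda>x. suminf (\<lambda>i. ?f i x)) sequentially"
  proof (rule Weierstrass_m_test)
    show "norm (?f n x) \<le> 2 * D * (3 / 5) ^ n" if "x \<in> SG" for n x
      using harmonic_approx_diff[OF that D] by simp
    show "summable (\<lambda>n. 2 * D * (3 / 5) ^ n)"
      by (intro summable_mult summable_geometric) simp
  qed
  moreover have "(\<Sum>i<n. ?f i x) = harmonic_approx n a x - harmonic_approx 0 a x" for n x
    by (rule sum_lessThan_telescope[of "\<lambda>n. harmonic_approx n a x"])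
  ultimately have "uniform_limit SG (\<lambda>n x. harmonic_approx n a x - harmonic_approx 0 a x)
      (\<lambda>x. suminf (\<lambda>i. ?f i x)) sequentially"
    by (simp only:)
  from uniform_limit_add[OF this uniform_limit_const[of "harmonic_approx 0 a"]]
  have lim: "uniform_limit SG (\<lambda>n. harmonic_approx n a)
      (\<lambda>x. suminf (\<lambda>i. ?f i x) + harmonic_approx 0 a x) sequentially"
    by (simp del: harmonic_approx.simps)
  moreover have "suminf (\<lambda>i. ?f i x) + harmonic_approx 0 a x = harmonic a x" if "x \<in> SG" for x
    unfolding harmonic_def by (rule limI[OF tendsto_uniform_limitI[OF lim that], symmetric])
  ultimately show ?thesis
    by (subst uniform_limit_cong'[where g="\<lambda>n. harmonic_approx n a"]) auto
qed

lemma continuous_on_harmonic: "continuous_on SG (harmonic a)"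
  by (rule uniform_limit_theorem[OF _ uniform_limit_harmonic])
    (simp_all add: continuous_on_harmonic_approx del: harmonic_approx.simps)

lemma harmonic_tendsto: "x \<in> SG \<Longrightarrow> (\<lambda>n. harmonic_approx n a x) \<longlonglongrightarrow> harmonic a x"
  by (rule tendsto_uniform_limitI[OF uniform_limit_harmonic])

lemma harmonic_vertex [simp]: "harmonic a (sg_vertex i) = a i"
  unfolding harmonic_def harmonic_approx_vertex by simp

lemma harmonic_map:
  assumes "x \<in> SG"
  shows "harmonic a (sg_map i x) = harmonic (harmonic_step i a) x"
proof (rule LIMSEQ_unique)
  show "(\<lambda>n. harmonic_approx (Suc n) a (sg_map i x)) \<longlonglongrightarrow> harmonic a (sg_map i x)"
    by (intro LIMSEQ_Suc harmonic_tendsto sg_map_in_SG assms)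
  show "(\<lambda>n. harmonic_approx (Suc n) a (sg_map i x)) \<longlonglongrightarrow> harmonic (harmonic_step i a) x"
    unfolding harmonic_approx_map[OF assms] by (rule harmonic_tendsto[OF assms])
qed

text \<open>The 2/5 - 2/5 - 1/5 rule makes the terms with the values of \<open>v\<close> at
  midpoints cancel, so the mixed energy sees only the corners, at every level. This gives at once
  finite energy and, for \<open>v\<close> vanishing on the boundary, the weak equation with right
  side 0.\<close>

lemma graph_energy_harmonic:
  "graph_energy m (harmonic a) v = triangle_energy a (\<lambda>i. v (sg_vertex i))"
proof (induction m arbitrary: a v)
  case 0
  show ?case
    by (simp add: graph_energy_0)
next
  case (Suc m)
  have "graph_energy (Suc m) (harmonic a) v
    = 5 / 3 * (\<Sum>i\<in>UNIV. graph_energy m (harmonic (harmonic_step i a)) (\<lambda>x. v (sg_map i x)))"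
    unfolding graph_energy_Suc
    by (intro arg_cong2[of _ _ _ _ "(*)"] refl sum.cong graph_energy_cong harmonic_map)
  also have "\<dots> = triangle_energy a (\<lambda>i. v (sg_vertex i))"
    unfolding Suc sum_mod3 triangle_energy_def harmonic_step_def
      sg_map_vertex_commute[of 1 0] sg_map_vertex_commute[of 2 1] sg_map_vertex_commute[of 0 2]
    by (simp add: field_simps)
  finally show ?case .
qed

lemma harmonic_in_energy_domain: "harmonic a \<in> energy_domain"
  by (intro energy_domainI[of _ "triangle_energy a a"] continuous_on_harmonic)
    (simp add: graph_energy_harmonic)

lemma harmonic_approx_nonneg:
  "x \<in> SG \<Longrightarrow> (\<And>i. 0 \<le> a i) \<Longrightarrow> 0 \<le> harmonic_approx n a x"
proof (induction n arbitrary: a x)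
  case 0
  then show ?case
    by (auto intro!: sum_nonneg mult_nonneg_nonneg bary_nonneg)
next
  case (Suc n)
  obtain i y where y: "y \<in> SG" "x = sg_map i y"
    using SG_cases[OF Suc(2)] .
  have "0 \<le> harmonic_step i a j" for j
    using Suc(3) by (simp add: harmonic_step_def sum_nonneg)
  then show ?case
    unfolding y(2) harmonic_approx_map[OF y(1)] by (intro Suc(1) y)
qed

lemma harmonic_nonneg: "x \<in> SG \<Longrightarrow> (\<And>i. 0 \<le> a i) \<Longrightarrow> 0 \<le> harmonic a x"
  by (rule LIMSEQ_le_const[OF harmonic_tendsto]) (auto intro!: harmonic_approx_nonneg)

definition dirichlet_domain :: "(plane \<Rightarrow> real) set" where
  "dirichlet_domain = {u \<in> energy_domain. \<forall>i. u (sg_vertex i) = 0}"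

text \<open>The basic bump is 1 at the three midpoints of the sides, 0 on the boundary, and harmonic on
  the cells of level 1.\<close>

lemma ex_bump_SG:
  "\<exists>v\<in>dirichlet_domain. (\<forall>x\<in>SG. 0 \<le> v x) \<and> (\<exists>y\<in>SG. 0 < v y)"
proof -
  define t where "t i j = (if i = j then 0 else 1 :: real)" for i j :: 3
  define v where "v = glue (\<lambda>i. harmonic (t i))"
  have comp: "compatible (\<lambda>i. harmonic (t i))"
    by (auto simp: compatible_def t_def)
  have "graph_energy m v v \<le> 5 / 3 * (\<Sum>i\<in>UNIV. triangle_energy (t i) (t i))" for m
    using incseqD[OF incseq_graph_energy, of m "Suc m" v]
    by (simp add: v_def graph_energy_glue[OF comp] graph_energy_harmonic)
  then have "v \<in> energy_domain"
    unfolding v_def by (intro energy_domainI continuous_on_glue comp continuous_on_harmonic)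
  then have "v \<in> dirichlet_domain"
    by (simp add: dirichlet_domain_def v_def glue_vertex[OF comp] t_def)
  moreover have "0 \<le> v x" if x: "x \<in> SG" for x
  proof -
    obtain i y where y: "y \<in> SG" "x = sg_map i y"
      using SG_cases[OF x] .
    then show ?thesis
      unfolding v_def by (simp add: glue_map[OF comp] harmonic_nonneg t_def)
  qed
  moreover have "v (sg_map 0 (sg_vertex 1)) = 1"
    unfolding v_def by (simp add: glue_map[OF comp] t_def)
  ultimately show ?thesis
    by (intro bexI[of _ v] conjI ballI bexI[of _ "sg_map 0 (sg_vertex 1)"]) auto
qed

text \<open>A bump in \<open>sg_cell w\<close> is transplanted into cell \<open>i\<close> and
  extended by zero. Its zero boundary values make this extension compatible, and the energy bound
  grows only by 5/3.\<close>

lemma ex_bump: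
  "\<exists>v\<in>dirichlet_domain. (\<forall>x\<in>SG. 0 \<le> v x) \<and> (\<forall>x\<in>SG - sg_cell w. v x = 0) \<and>
     (\<exists>y\<in>sg_cell w. 0 < v y)"
proof (induction w)
  case Nil
  then show ?case
    using ex_bump_SG by simp
next
  case (Cons i w)
  then obtain u y where u: "u \<in> dirichlet_domain" "\<And>x. x \<in> SG \<Longrightarrow> 0 \<le> u x"
    "\<And>x. x \<in> SG \<Longrightarrow> x \<notin> sg_cell w \<Longrightarrow> u x = 0" and y: "y \<in> sg_cell w" "0 < u y"
    by blast
  define f where "f j = (if j = i then u else (\<lambda>_. 0))" for j
  have u0: "u (sg_vertex j) = 0" for j
    using u(1) by (simp add: dirichlet_domain_def)
  have uE: "u \<in> energy_domain"
    using u(1) by (simp add: dirichlet_domain_def)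
  obtain B where B: "\<And>m. graph_energy m u u \<le> B"
    using energy_domain_bounded[OF uE] by blast
  have comp: "compatible f"
    by (simp add: compatible_def f_def u0)
  have zero: "graph_energy m (\<lambda>_. 0) (\<lambda>_. 0) = 0" for m
    by (simp add: graph_energy_def case_prod_unfold)
  have "graph_energy m (glue f) (glue f) \<le> 5 / 3 * B" for m
  proof -
    \<comment> \<open>The formula for glued functions concerns positive levels, so the level is
      raised first by monotonicity.\<close>
    have "graph_energy m (glue f) (glue f) \<le> graph_energy (Suc m) (glue f) (glue f)"
      by (rule graph_energy_le_Suc)
    also have "\<dots> = 5 / 3 * (\<Sum>j\<in>UNIV. if j = i then graph_energy m u u else 0)"
      unfolding graph_energy_glue[OF comp]
      by (intro arg_cong2[of _ _ _ _ "(*)"] refl sum.cong) (simp add: f_def zero)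
    also have "\<dots> \<le> 5 / 3 * B"
      using B[of m] by simp
    finally show ?thesis .
  qed
  moreover have "continuous_on SG (f j)" for j
    using energy_domain_continuous[OF uE] by (simp add: f_def)
  ultimately have "glue f \<in> energy_domain"
    by (intro energy_domainI continuous_on_glue comp)
  then have "glue f \<in> dirichlet_domain"
    by (simp add: dirichlet_domain_def glue_vertex[OF comp] f_def u0)
  moreover have "0 \<le> glue f x \<and> (x \<notin> sg_cell (i # w) \<longrightarrow> glue f x = 0)" if x: "x \<in> SG" for x
  proof -
    obtain j z where "z \<in> SG" "x = sg_map j z"
      using SG_cases[OF x] .
    then show ?thesis
      using u(2,3) by (auto simp: glue_map[OF comp] f_def sg_cell_Cons)
  qed
  moreover have "0 < glue f (sg_map i y)" "sg_map i y \<in> sg_cell (i # w)"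
    using y sg_cell_subset[of w] by (auto simp: glue_map[OF comp] f_def sg_cell_Cons)
  ultimately show ?case
    by blast
qed

section \<open>The Laplacian\<close>

lemma continuous_mult_integrable:
  fixes f g :: "plane \<Rightarrow> real"
  assumes "continuous_on SG f" "continuous_on SG g"
  shows "integrable sg_measure (\<lambda>x. f x * g x)"
  by (intro sg.continuous_integrable continuous_intros assms)

lemma l2_inner_commute: "l2_inner f g = l2_inner g f"
  by (simp add: l2_inner_def mult.commute)

lemma l2_inner_cong:
  assumes "\<And>x. x \<in> SG \<Longrightarrow> f x = f' x" "\<And>x. x \<in> SG \<Longrightarrow> g x = g' x"
  shows "l2_inner f g = l2_inner f' g'"
  unfolding l2_inner_def using assms by (intro Bochner_Integration.integral_cong refl) (simp add: sg.space_eq)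

lemma l2_inner_add_left:
  assumes "continuous_on SG f" "continuous_on SG f'" "continuous_on SG g"
  shows "l2_inner (\<lambda>x. f x + f' x) g = l2_inner f g + l2_inner f' g"
  unfolding l2_inner_def distrib_right
  by (intro Bochner_Integration.integral_add continuous_mult_integrable assms)

lemma l2_inner_scale_left: "l2_inner (\<lambda>x. c * f x) g = c * l2_inner f g"
  unfolding l2_inner_def mult.assoc by (rule integral_mult_right_zero)

lemma l2_inner_nonneg: "0 \<le> l2_inner f f"
  by (simp add: l2_inner_def)

lemma l2_inner_eq_0_imp:
  assumes "continuous_on SG f" "l2_inner f f = 0" "x \<in> SG"
  shows "f x = 0"
  using sg.integral_eq_0_imp[of "\<lambda>x. f x * f x" x] assms
  by (auto simp: l2_inner_def intro!: continuous_intros)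

text \<open>The fundamental lemma of the calculus of variations: near a point where \<open>f\<close>
  is not zero there is a cell on which \<open>f\<close> keeps its sign, and a bump in that cell
  detects it.\<close>

lemma dirichlet_domain_nondegenerate:
  assumes f: "continuous_on SG f" and orth: "\<And>v. v \<in> dirichlet_domain \<Longrightarrow> l2_inner f v = 0"
    and x: "x \<in> SG"
  shows "f x = 0"
proof (rule ccontr)
  assume ne: "f x \<noteq> 0"
  define s where "s = sgn (f x)"
  have "0 < \<bar>f x\<bar>"
    using ne by simp
  then obtain d where d: "0 < d" "\<And>y. y \<in> SG \<Longrightarrow> dist y x < d \<Longrightarrow> \<bar>f y - f x\<bar> < \<bar>f x\<bar>"
    using f x unfolding continuous_on_iff dist_real_def by blast
  obtain w where w: "x \<in> sg_cell w" "\<And>y. y \<in> sg_cell w \<Longrightarrow> dist y x < d"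
    using ex_small_cell[OF x d(1)] by blast
  have pos: "0 < s * f y" if y: "y \<in> sg_cell w" for y
  proof -
    have "\<bar>f y - f x\<bar> < \<bar>f x\<bar>"
      using y w(2) sg_cell_subset[of w] by (intro d(2)) auto
    then show ?thesis
      unfolding s_def sgn_if by auto
  qed
  obtain v y where v: "v \<in> dirichlet_domain" "\<And>x. x \<in> SG \<Longrightarrow> 0 \<le> v x"
    "\<And>x. x \<in> SG \<Longrightarrow> x \<notin> sg_cell w \<Longrightarrow> v x = 0" and y: "y \<in> sg_cell w" "0 < v y"
    using ex_bump[of w] by blast
  have "0 \<le> s * f z * v z" if z: "z \<in> SG" for z
    using v(2,3)[OF z] pos[of z] by (cases "z \<in> sg_cell w") (auto intro: mult_nonneg_nonneg less_imp_le)
  moreover have "continuous_on SG (\<lambda>z. s * f z * v z)"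
    using v(1) energy_domain_continuous by (intro continuous_intros f) (auto simp: dirichlet_domain_def)
  moreover have "(\<integral>z. s * f z * v z \<partial>sg_measure) = 0"
    using orth[OF v(1)] by (simp add: l2_inner_def mult.assoc)
  moreover have "y \<in> SG"
    using y sg_cell_subset[of w] by blast
  ultimately have "s * f y * v y = 0"
    by (intro sg.integral_eq_0_imp[of "\<lambda>z. s * f z * v z"]) auto
  then show False
    using mult_pos_pos[OF pos[OF y(1)] y(2)] by linarith
qed

lemma has_laplacian_iff:
  "has_laplacian u f \<longleftrightarrow> u \<in> energy_domain \<and> continuous_on SG f \<and>
     (\<forall>v\<in>dirichlet_domain. energy u v = - l2_inner f v)"
  by (auto simp: has_laplacian_def dirichlet_domain_def sg_boundary_def)

lemma dirichlet_domain_energy_domain: "v \<in> dirichlet_domain \<Longrightarrow> v \<in> energy_domain"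
  by (simp add: dirichlet_domain_def)

lemma has_laplacianD:
  assumes "has_laplacian u f"
  shows "u \<in> energy_domain" "continuous_on SG f" "continuous_on SG u"
    "v \<in> dirichlet_domain \<Longrightarrow> energy u v = - l2_inner f v"
  using assms energy_domain_continuous by (auto simp: has_laplacian_iff)

lemma has_laplacian_cong:
  assumes "\<And>x. x \<in> SG \<Longrightarrow> u x = u' x" "\<And>x. x \<in> SG \<Longrightarrow> f x = f' x"
  shows "has_laplacian u f \<longleftrightarrow> has_laplacian u' f'"
proof -
  have "u \<in> energy_domain \<longleftrightarrow> u' \<in> energy_domain"
    by (rule energy_domain_cong[OF assms(1)])
  moreover have "continuous_on SG f \<longleftrightarrow> continuous_on SG f'"
    by (rule continuous_on_cong[OF refl assms(2)])
  moreover have "energy u v = energy u' v" for v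
    by (rule energy_cong[OF assms(1) refl])
  moreover have "l2_inner f v = l2_inner f' v" for v
    by (rule l2_inner_cong[OF assms(2) refl])
  ultimately show ?thesis
    by (simp add: has_laplacian_iff)
qed

lemma has_laplacian_cong_right:
  assumes "has_laplacian u f" "\<And>x. x \<in> SG \<Longrightarrow> f x = g x"
  shows "has_laplacian u g"
  using has_laplacian_cong[of u u f g, OF refl assms(2)] assms(1) by blast

lemma has_laplacian_add:
  assumes "has_laplacian u f" "has_laplacian v g"
  shows "has_laplacian (\<lambda>x. u x + v x) (\<lambda>x. f x + g x)"
  unfolding has_laplacian_iff
proof (intro conjI ballI)
  note u = has_laplacianD[OF assms(1)] and v = has_laplacianD[OF assms(2)]
  show "(\<lambda>x. u x + v x) \<in> energy_domain"
    by (rule energy_domain_add[OF u(1) v(1)])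
  show "continuous_on SG (\<lambda>x. f x + g x)"
    by (rule continuous_on_add[OF u(2) v(2)])
  fix h assume h: "h \<in> dirichlet_domain"
  note hE = dirichlet_domain_energy_domain[OF h]
  show "energy (\<lambda>x. u x + v x) h = - l2_inner (\<lambda>x. f x + g x) h"
    using u(4)[OF h] v(4)[OF h] energy_add_left[OF u(1) v(1) hE]
      l2_inner_add_left[OF u(2) v(2) energy_domain_continuous[OF hE]] by simp
qed

lemma has_laplacian_scale:
  assumes "has_laplacian u f"
  shows "has_laplacian (\<lambda>x. c * u x) (\<lambda>x. c * f x)"
  unfolding has_laplacian_iff
proof (intro conjI ballI)
  note u = has_laplacianD[OF assms]
  show "(\<lambda>x. c * u x) \<in> energy_domain"
    by (rule energy_domain_scale[OF u(1)])
  show "continuous_on SG (\<lambda>x. c * f x)"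
    by (rule continuous_on_mult_left[OF u(2)])
  fix h assume h: "h \<in> dirichlet_domain"
  show "energy (\<lambda>x. c * u x) h = - l2_inner (\<lambda>x. c * f x) h"
    using u(4)[OF h] energy_scale_left[OF u(1) dirichlet_domain_energy_domain[OF h]]
    by (simp add: l2_inner_scale_left)
qed

lemma has_laplacian_diff:
  assumes "has_laplacian u f" "has_laplacian v g"
  shows "has_laplacian (\<lambda>x. u x - v x) (\<lambda>x. f x - g x)"
  using has_laplacian_add[OF assms(1) has_laplacian_scale[OF assms(2), of "- 1"]] by simp

lemma has_laplacian_unique:
  assumes "has_laplacian u f" "has_laplacian u g" "x \<in> SG"
  shows "f x = g x"
proof -
  note d = has_laplacian_diff[OF assms(1,2)]
  have "energy (\<lambda>x. u x - u x) v = 0" for v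
    by (simp add: energy_def graph_energy_def case_prod_unfold)
  then have "l2_inner (\<lambda>x. f x - g x) v = 0" if "v \<in> dirichlet_domain" for v
    using has_laplacianD(4)[OF d that] by simp
  from dirichlet_domain_nondegenerate[OF has_laplacianD(2)[OF d] this assms(3)]
  show ?thesis
    by simp
qed

text \<open>Makes the definite description of \<open>laplacian\<close> usable: uniqueness on
  \<open>SG\<close> comes from the bumps, and elsewhere from the normalization to 0.\<close>

lemma laplacian_properties:
  assumes "has_laplacian u f"
  shows "has_laplacian u (laplacian u) \<and> (\<forall>x. x \<notin> SG \<longrightarrow> laplacian u x = 0)"
  unfolding laplacian_def
proof (rule theI'[where P="\<lambda>f. has_laplacian u f \<and> (\<forall>x. x \<notin> SG \<longrightarrow> f x = 0)"])
  show "\<exists>!g. has_laplacian u g \<and> (\<forall>x. x \<notin> SG \<longrightarrow> g x = 0)"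
  proof (rule ex_ex1I)
    have "has_laplacian u (\<lambda>x. if x \<in> SG then f x else 0)"
      using assms has_laplacian_cong[of u u f "\<lambda>x. if x \<in> SG then f x else 0"] by simp
    then show "\<exists>g. has_laplacian u g \<and> (\<forall>x. x \<notin> SG \<longrightarrow> g x = 0)"
      by (intro exI[of _ "\<lambda>x. if x \<in> SG then f x else 0"]) simp
  next
    fix g h
    assume gh: "has_laplacian u g \<and> (\<forall>x. x \<notin> SG \<longrightarrow> g x = 0)"
      "has_laplacian u h \<and> (\<forall>x. x \<notin> SG \<longrightarrow> h x = 0)"
    then have "g x = h x" for x
      using has_laplacian_unique[of u g h x] by (cases "x \<in> SG") auto
    then show "g = h"
      by (rule ext)
  qed
qed

lemma has_laplacian_laplacian: "u \<in> laplacian_domain \<Longrightarrow> has_laplacian u (laplacian u)"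
  unfolding laplacian_domain_def using laplacian_properties by blast

lemma laplacian_domainI: "has_laplacian u f \<Longrightarrow> u \<in> laplacian_domain"
  by (auto simp: laplacian_domain_def)

lemma laplacian_eqI: "has_laplacian u f \<Longrightarrow> x \<in> SG \<Longrightarrow> laplacian u x = f x"
  using has_laplacian_unique[OF has_laplacian_laplacian[OF laplacian_domainI]] by blast

lemma laplacian_domain_continuous: "u \<in> laplacian_domain \<Longrightarrow> continuous_on SG u"
  using has_laplacianD(3)[OF has_laplacian_laplacian] .

lemma continuous_on_laplacian: "u \<in> laplacian_domain \<Longrightarrow> continuous_on SG (laplacian u)"
  using has_laplacianD(2)[OF has_laplacian_laplacian] .

lemma laplacian_domain_add:
  "u \<in> laplacian_domain \<Longrightarrow> v \<in> laplacian_domain \<Longrightarrow> (\<lambda>x. u x + v x) \<in> laplacian_domain"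
  using laplacian_domainI has_laplacian_add by (blast dest: has_laplacian_laplacian)

lemma laplacian_domain_scale:
  "u \<in> laplacian_domain \<Longrightarrow> (\<lambda>x. c * u x) \<in> laplacian_domain"
  using laplacian_domainI has_laplacian_scale by (blast dest: has_laplacian_laplacian)

lemma laplacian_add:
  "u \<in> laplacian_domain \<Longrightarrow> v \<in> laplacian_domain \<Longrightarrow> x \<in> SG \<Longrightarrow>
    laplacian (\<lambda>x. u x + v x) x = laplacian u x + laplacian v x"
  by (rule laplacian_eqI[OF has_laplacian_add[OF has_laplacian_laplacian has_laplacian_laplacian]])

lemma laplacian_scale:
  "u \<in> laplacian_domain \<Longrightarrow> x \<in> SG \<Longrightarrow> laplacian (\<lambda>x. c * u x) x = c * laplacian u x"
  by (rule laplacian_eqI[OF has_laplacian_scale[OF has_laplacian_laplacian]])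

lemma has_laplacian_harmonic: "has_laplacian (harmonic a) (\<lambda>_. 0)"
  unfolding has_laplacian_iff
proof (intro conjI ballI)
  fix v assume "v \<in> dirichlet_domain"
  then have "graph_energy m (harmonic a) v = 0" for m
    by (simp add: graph_energy_harmonic dirichlet_domain_def triangle_energy_def)
  then show "energy (harmonic a) v = - l2_inner (\<lambda>_. 0) v"
    by (simp add: energy_def l2_inner_def)
qed (simp_all add: harmonic_in_energy_domain)

lemma dirichlet_domain_reflect: "v \<in> dirichlet_domain \<Longrightarrow> (\<lambda>x. v (sg_reflect x)) \<in> dirichlet_domain"
  by (simp add: dirichlet_domain_def energy_domain_reflect)

lemma has_laplacian_reflect:
  assumes "has_laplacian u f"
  shows "has_laplacian (\<lambda>x. u (sg_reflect x)) (\<lambda>x. f (sg_reflect x))"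
  unfolding has_laplacian_iff
proof (intro conjI ballI)
  note u = has_laplacianD[OF assms]
  show "(\<lambda>x. u (sg_reflect x)) \<in> energy_domain" "continuous_on SG (\<lambda>x. f (sg_reflect x))"
    using u by (simp_all add: energy_domain_reflect continuous_reflect)
  fix v assume v: "v \<in> dirichlet_domain"
  have "energy (\<lambda>x. u (sg_reflect x)) v = energy u (\<lambda>x. v (sg_reflect x))"
    using energy_reflect[of u "\<lambda>x. v (sg_reflect x)"] by simp
  also have "\<dots> = - l2_inner f (\<lambda>x. v (sg_reflect x))"
    by (rule u(4)[OF dirichlet_domain_reflect[OF v]])
  also have "l2_inner f (\<lambda>x. v (sg_reflect x)) = l2_inner (\<lambda>x. f (sg_reflect x)) v"
  proof -
    have "continuous_on SG (\<lambda>x. f x * v (sg_reflect x))"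
      using v by (intro continuous_intros u(2) continuous_reflect energy_domain_continuous
          dirichlet_domain_energy_domain)
    from integral_sg_reflect[OF this] show ?thesis
      by (simp add: l2_inner_def)
  qed
  finally show "energy (\<lambda>x. u (sg_reflect x)) v = - l2_inner (\<lambda>x. f (sg_reflect x)) v" .
qed

section \<open>Jets of harmonic functions and monomials\<close>

lemma funpow_sg_map_in_SG [simp]: "x \<in> SG \<Longrightarrow> (sg_map i ^^ m) x \<in> SG"
  by (induction m) simp_all

text \<open>One step towards q_0 multiplies \<open>2 * a 0 - a 1 - a 2\<close> by 3/5 (and
  \<open>a 1 - a 2\<close> by 1/5 in the next lemma). The normalizing powers cancel this exactly, so
  the sequences defining the derivatives are constant.\<close>

lemma harmonic_normal_scaling:
  "(5 / 3) ^ m * (2 * a 0 - harmonic a ((sg_map 0 ^^ m) (sg_vertex 1))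
      - harmonic a ((sg_map 0 ^^ m) (sg_vertex 2))) = 2 * a 0 - a 1 - a 2"
proof (induction m arbitrary: a)
  case (Suc m)
  let ?b = "harmonic_step 0 a"
  have "(5 / 3) ^ Suc m * (2 * a 0 - harmonic a ((sg_map 0 ^^ Suc m) (sg_vertex 1))
      - harmonic a ((sg_map 0 ^^ Suc m) (sg_vertex 2)))
    = 5 / 3 * ((5 / 3) ^ m * (2 * ?b 0 - harmonic ?b ((sg_map 0 ^^ m) (sg_vertex 1))
      - harmonic ?b ((sg_map 0 ^^ m) (sg_vertex 2))))"
    by (simp add: harmonic_map) (simp add: harmonic_step_def)
  also have "\<dots> = 2 * a 0 - a 1 - a 2"
    unfolding Suc by (simp add: harmonic_step_def sum_mod3 field_simps)
  finally show ?case .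
qed simp

lemma harmonic_tangential_scaling:
  "5 ^ m * (harmonic a ((sg_map 0 ^^ m) (sg_vertex 1)) - harmonic a ((sg_map 0 ^^ m) (sg_vertex 2)))
    = a 1 - a 2"
proof (induction m arbitrary: a)
  case (Suc m)
  let ?b = "harmonic_step 0 a"
  have "5 ^ Suc m * (harmonic a ((sg_map 0 ^^ Suc m) (sg_vertex 1))
      - harmonic a ((sg_map 0 ^^ Suc m) (sg_vertex 2)))
    = 5 * (5 ^ m * (harmonic ?b ((sg_map 0 ^^ m) (sg_vertex 1))
      - harmonic ?b ((sg_map 0 ^^ m) (sg_vertex 2))))"
    by (simp add: harmonic_map)
  also have "\<dots> = a 1 - a 2"
    unfolding Suc by (simp add: harmonic_step_def sum_mod3 field_simps)
  finally show ?case .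
qed simp

lemma has_normal_derivative_0_iff:
  "has_normal_derivative u d 0 \<longleftrightarrow>
    (\<lambda>m. (5 / 3) ^ m * (2 * u (sg_vertex 0) - u ((sg_map 0 ^^ m) (sg_vertex 1))
      - u ((sg_map 0 ^^ m) (sg_vertex 2)))) \<longlonglongrightarrow> d"
  by (simp add: has_normal_derivative_def)

lemma has_tangential_derivative_0_iff:
  "has_tangential_derivative u d 0 \<longleftrightarrow>
    (\<lambda>m. 5 ^ m * (u ((sg_map 0 ^^ m) (sg_vertex 1)) - u ((sg_map 0 ^^ m) (sg_vertex 2)))) \<longlonglongrightarrow> d"
  by (simp add: has_tangential_derivative_def)

lemma has_normal_derivative_diff:
  assumes "has_normal_derivative u d i" "has_normal_derivative v e i"
  shows "has_normal_derivative (\<lambda>x. u x - v x) (d - e) i"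
proof -
  have alg: "A * (2 * x - y - z) - A * (2 * x' - y' - z') = A * (2 * (x - x') - (y - y') - (z - z'))"
    for A x y z x' y' z' :: real
    by (simp add: algebra_simps)
  show ?thesis
    using tendsto_diff[OF assms[unfolded has_normal_derivative_def]]
    unfolding has_normal_derivative_def alg .
qed

lemma has_tangential_derivative_diff:
  assumes "has_tangential_derivative u d i" "has_tangential_derivative v e i"
  shows "has_tangential_derivative (\<lambda>x. u x - v x) (d - e) i"
proof -
  have alg: "A * (y - z) - A * (y' - z') = A * ((y - y') - (z - z'))" for A y z y' z' :: real
    by (simp add: algebra_simps)
  show ?thesis
    using tendsto_diff[OF assms[unfolded has_tangential_derivative_def]]
    unfolding has_tangential_derivative_def alg .
qed

lemma has_normal_derivative_scale_reflect:
  assumes "has_normal_derivative u d 0"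
  shows "has_normal_derivative (\<lambda>x. c * u (sg_reflect x)) (c * d) 0"
proof -
  have alg: "c * (A * (2 * x - y - z)) = A * (2 * (c * x) - c * z - c * y)" for A x y z :: real
    by (simp add: algebra_simps)
  show ?thesis
    using tendsto_mult_left[OF assms[unfolded has_normal_derivative_0_iff], of c]
    unfolding has_normal_derivative_0_iff sg_reflect_funpow sg_reflect_vertex mod3_arith minus_zero alg .
qed

text \<open>Reflection exchanges the two neighbours of q_0, so the tangential derivative, unlike the
  normal one, changes sign.\<close>

lemma has_tangential_derivative_scale_reflect:
  assumes "has_tangential_derivative u d 0"
  shows "has_tangential_derivative (\<lambda>x. c * u (sg_reflect x)) (- c * d) 0"
proof -
  have alg: "- c * (A * (y - z)) = A * (c * z - c * y)" for A y z :: real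
    by (simp add: algebra_simps)
  show ?thesis
    using tendsto_mult_left[OF assms[unfolded has_tangential_derivative_0_iff], of "- c"]
    unfolding has_tangential_derivative_0_iff sg_reflect_funpow sg_reflect_vertex mod3_arith alg .
qed

locale gasket_green =
  fixes G :: "plane \<Rightarrow> plane \<Rightarrow> real"
  assumes green: "green_function G"
begin

lemma green_representation:
  assumes "has_laplacian u f" "\<And>i. u (sg_vertex i) = 0" "x \<in> SG"
  shows "u x = - (\<integral>y. G x y * f y \<partial>sg_measure)"
proof -
  have "continuous_on SG (\<lambda>x. - f x)"
    using has_laplacianD(2)[OF assms(1)] by (rule continuous_on_minus)
  moreover have "has_laplacian u (\<lambda>x. - (- f x)) \<and> (\<forall>x\<in>sg_boundary. u x = 0)"
    using assms(1,2) by (simp add: sg_boundary_def)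
  ultimately have "u x = (\<integral>y. G x y * (- f y) \<partial>sg_measure)"
    using green assms(3) unfolding green_function_def by blast
  then show ?thesis
    by simp
qed

lemma harmonic_eq_0:
  assumes "has_laplacian u (\<lambda>_. 0)" "\<And>i. u (sg_vertex i) = 0" "x \<in> SG"
  shows "u x = 0"
  using green_representation[OF assms] by simp

lemma has_laplacian_0_imp_harmonic:
  assumes "has_laplacian u (\<lambda>_. 0)" "x \<in> SG"
  shows "u x = harmonic (\<lambda>i. u (sg_vertex i)) x"
  using harmonic_eq_0[of "\<lambda>x. u x - harmonic (\<lambda>i. u (sg_vertex i)) x" x] assms
    has_laplacian_diff[OF assms(1) has_laplacian_harmonic[of "\<lambda>i. u (sg_vertex i)"]] by simp

text \<open>Such a function is \<open>harmonic a\<close> on \<open>SG\<close>, and its jet at q_0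
  consists of \<open>a 0\<close>, \<open>2 * a 0 - a 1 - a 2\<close> and \<open>a 1 - a 2\<close>,
  three independent linear forms in the boundary values.\<close>

lemma jet_eq_0_imp:
  assumes u: "has_laplacian u (\<lambda>_. 0)" and val: "u (sg_vertex 0) = 0"
    and der: "has_normal_derivative u 0 0" "has_tangential_derivative u 0 0" and x: "x \<in> SG"
  shows "u x = 0"
proof (rule harmonic_eq_0[OF u _ x])
  define a where "a i = u (sg_vertex i)" for i
  have eq: "u y = harmonic a y" if "y \<in> SG" for y
    using has_laplacian_0_imp_harmonic[OF u that] by (simp add: a_def[abs_def])
  have "(\<lambda>m. 2 * a 0 - a 1 - a 2) \<longlonglongrightarrow> 0"
    using der(1) unfolding has_normal_derivative_0_iff by (simp add: eq harmonic_normal_scaling)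
  moreover have "(\<lambda>m. a 1 - a 2) \<longlonglongrightarrow> 0"
    using der(2) unfolding has_tangential_derivative_0_iff by (simp add: eq harmonic_tangential_scaling)
  ultimately have "2 * a 0 - a 1 - a 2 = 0" "a 1 - a 2 = 0"
    by (simp_all add: LIMSEQ_const_iff)
  moreover have "a 0 = 0"
    by (simp add: a_def val)
  ultimately have "a 1 = 0" "a 2 = 0"
    by linarith+
  then show "u (sg_vertex i) = 0" for i
    using val by (cases i rule: mod3_cases) (simp_all add: a_def)
qed

text \<open>Descending induction: if the chains agree at \<open>Suc n\<close>, their difference at
  \<open>n\<close> is harmonic with zero jet. Chains are arbitrary sequences linked by
  \<open>has_laplacian\<close>, since reflected or shifted monomials are compared without being
  iterates of \<open>laplacian\<close> as functions on the whole plane.\<close>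

lemma chain_unique:
  fixes u v :: "nat \<Rightarrow> plane \<Rightarrow> real"
  assumes u: "\<And>n. n \<le> j \<Longrightarrow> has_laplacian (u n) (u (Suc n))"
    and v: "\<And>n. n \<le> j \<Longrightarrow> has_laplacian (v n) (v (Suc n))"
    and val: "\<And>n. n \<le> j \<Longrightarrow> u n (sg_vertex 0) = v n (sg_vertex 0)"
    and normal: "\<And>n. n \<le> j \<Longrightarrow> has_normal_derivative (u n) (d n) 0"
      "\<And>n. n \<le> j \<Longrightarrow> has_normal_derivative (v n) (d n) 0"
    and tangential: "\<And>n. n \<le> j \<Longrightarrow> has_tangential_derivative (u n) (e n) 0"
      "\<And>n. n \<le> j \<Longrightarrow> has_tangential_derivative (v n) (e n) 0"
    and last: "\<And>x. x \<in> SG \<Longrightarrow> u (Suc j) x = v (Suc j) x"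
    and n: "n \<le> Suc j" and x: "x \<in> SG"
  shows "u n x = v n x"
proof -
  have "\<forall>x\<in>SG. u n x = v n x"
    using n
  proof (induction n rule: inc_induct)
    case base
    show ?case
      using last by blast
  next
    case (step n)
    then have n: "n \<le> j"
      by simp
    have "has_laplacian (\<lambda>x. u n x - v n x) (\<lambda>_. 0)"
      by (rule has_laplacian_cong_right[OF has_laplacian_diff[OF u[OF n] v[OF n]]])
        (simp only: step.IH[rule_format] diff_self)
    moreover have "has_normal_derivative (\<lambda>x. u n x - v n x) 0 0"
      using has_normal_derivative_diff[OF normal(1)[OF n] normal(2)[OF n]] unfolding diff_self .
    moreover have "has_tangential_derivative (\<lambda>x. u n x - v n x) 0 0"
      using has_tangential_derivative_diff[OF tangential(1)[OF n] tangential(2)[OF n]] unfolding diff_self .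
    moreover have "u n (sg_vertex 0) - v n (sg_vertex 0) = 0"
      unfolding val[OF n] by (rule diff_self)
    ultimately have "u n y - v n y = 0" if y: "y \<in> SG" for y
      using jet_eq_0_imp[of "\<lambda>x. u n x - v n x", OF _ _ _ _ y] by blast
    then show ?case
      unfolding right_minus_eq by blast
  qed
  with x show ?thesis
    by blast
qed

end

section \<open>Monomials: shift under the Laplacian and parity\<close>

lemma monomial_chain:
  assumes "monomial_function j k u" "n \<le> j"
  shows "has_laplacian ((laplacian ^^ n) u) ((laplacian ^^ Suc n) u)"
    "(laplacian ^^ n) u (sg_vertex 0) = of_bool (n = j \<and> k = 1)"
    "has_normal_derivative ((laplacian ^^ n) u) (of_bool (n = j \<and> k = 2)) 0"
    "has_tangential_derivative ((laplacian ^^ n) u) (of_bool (n = j \<and> k = 3)) 0"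
proof -
  have "(laplacian ^^ n) u \<in> laplacian_domain"
    using assms unfolding monomial_function_def by blast
  then show "has_laplacian ((laplacian ^^ n) u) ((laplacian ^^ Suc n) u)"
    using has_laplacian_laplacian by simp
qed (use assms in \<open>unfold monomial_function_def, blast+\<close>)

lemma monomial_last:
  assumes "monomial_function j k u" "x \<in> SG"
  shows "(laplacian ^^ Suc j) u x = 0"
  using assms by (simp add: monomial_function_def)

lemma monomial_in_domain: "monomial_function j k u \<Longrightarrow> u \<in> laplacian_domain"
  using laplacian_domainI monomial_chain(1)[of j k u 0] by simp

context gasket_green
begin

text \<open>Dropping the first term of the chain of \<open>u\<close> turns the jet conditions for
  \<open>Suc j\<close> into those for \<open>j\<close>.\<close>

lemma laplacian_monomial_Suc:
  assumes u: "monomial_function (Suc j) k u" and v: "monomial_function j k v" and x: "x \<in> SG"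
  shows "laplacian u x = v x"
proof -
  let ?u = "\<lambda>n. (laplacian ^^ Suc n) u" and ?v = "\<lambda>n. (laplacian ^^ n) v"
  have "?u 0 x = ?v 0 x"
  proof (rule chain_unique[where j = j and d = "\<lambda>n. of_bool (n = j \<and> k = 2)"
        and e = "\<lambda>n. of_bool (n = j \<and> k = 3)"])
    fix n assume n: "n \<le> j"
    note U = monomial_chain[OF u, of "Suc n"] and V = monomial_chain[OF v n]
    show "has_laplacian (?u n) (?u (Suc n))"
      using U(1) n by simp
    show "has_laplacian (?v n) (?v (Suc n))"
      by (rule V(1))
    show "?u n (sg_vertex 0) = ?v n (sg_vertex 0)"
      using U(2) V(2) n by simp
    show "has_normal_derivative (?u n) (of_bool (n = j \<and> k = 2)) 0"
      using U(3) n by simp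
    show "has_normal_derivative (?v n) (of_bool (n = j \<and> k = 2)) 0"
      by (rule V(3))
    show "has_tangential_derivative (?u n) (of_bool (n = j \<and> k = 3)) 0"
      using U(4) n by simp
    show "has_tangential_derivative (?v n) (of_bool (n = j \<and> k = 3)) 0"
      by (rule V(4))
  next
    show "?u (Suc j) y = ?v (Suc j) y" if "y \<in> SG" for y
      using monomial_last[OF u that] monomial_last[OF v that] by simp
  qed (simp_all add: x)
  then show ?thesis
    by simp
qed

text \<open>The sign \<open>s\<close> is chosen so that reflecting and multiplying by
  \<open>s\<close> keeps the one nonzero jet entry: the normal derivative if \<open>k = 2\<close>,
  the tangential one if \<open>k = 3\<close>.\<close>

lemma monomial_reflect:
  assumes u: "monomial_function j k u" and k: "k = 2 \<and> s = 1 \<or> k = 3 \<and> s = - 1" and x: "x \<in> SG"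
  shows "s * u (sg_reflect x) = u x"
proof -
  let ?u = "\<lambda>n. (laplacian ^^ n) u" and ?v = "\<lambda>n x. s * (laplacian ^^ n) u (sg_reflect x)"
  have "?v 0 x = ?u 0 x"
  proof (rule chain_unique[where j = j and d = "\<lambda>n. of_bool (n = j \<and> k = 2)"
        and e = "\<lambda>n. of_bool (n = j \<and> k = 3)"])
    fix n assume n: "n \<le> j"
    note U = monomial_chain[OF u n]
    show "has_laplacian (?u n) (?u (Suc n))"
      by (rule U(1))
    show "has_laplacian (?v n) (?v (Suc n))"
      by (intro has_laplacian_scale has_laplacian_reflect U(1))
    show "?v n (sg_vertex 0) = ?u n (sg_vertex 0)"
      using U(2) k by auto
    show "has_normal_derivative (?u n) (of_bool (n = j \<and> k = 2)) 0"
      by (rule U(3))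
    show "has_normal_derivative (?v n) (of_bool (n = j \<and> k = 2)) 0"
      using has_normal_derivative_scale_reflect[OF U(3), of s] k by auto
    show "has_tangential_derivative (?u n) (of_bool (n = j \<and> k = 3)) 0"
      by (rule U(4))
    show "has_tangential_derivative (?v n) (of_bool (n = j \<and> k = 3)) 0"
      using has_tangential_derivative_scale_reflect[OF U(4), of s] k by auto
  next
    show "?v (Suc j) y = ?u (Suc j) y" if "y \<in> SG" for y
      using monomial_last[OF u, of "sg_reflect y"] monomial_last[OF u that] that by simp
  qed (simp_all add: x)
  then show ?thesis
    by simp
qed

lemma laplacian_monomial_0: "monomial_function 0 k u \<Longrightarrow> x \<in> SG \<Longrightarrow> laplacian u x = 0"
  using monomial_last[of 0 k u x] by simp

lemma monomial_vertex_0: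
  assumes "monomial_function j k u" "k \<noteq> 1"
  shows "u (sg_vertex 0) = 0"
  using monomial_chain(2)[OF assms(1), of 0] assms(2) by simp

lemma monomial_vertex_2:
  assumes "monomial_function j k u" "k = 2 \<and> s = 1 \<or> k = 3 \<and> s = - 1"
  shows "u (sg_vertex 2) = s * u (sg_vertex 1)"
  using monomial_reflect[OF assms sg_vertex_in_SG, of 2] unfolding sg_reflect_vertex mod3_arith
  by (rule sym)

text \<open>Otherwise parity and the zero at q_0 would make all boundary values vanish, hence
  \<open>u\<close> itself, against its derivative 1. This permits division by the value at q_1
  later.\<close>

lemma monomial_0_vertex_1:
  assumes u: "monomial_function 0 k u" and k: "k = 2 \<and> s = (1 :: real) \<or> k = 3 \<and> s = - 1"
  shows "u (sg_vertex 1) \<noteq> 0"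
proof
  assume 1: "u (sg_vertex 1) = 0"
  have 2: "u (sg_vertex 2) = 0"
    unfolding monomial_vertex_2[OF u k] 1 by (rule mult_zero_right)
  have 0: "u (sg_vertex 0) = 0"
    using k by (intro monomial_vertex_0[OF u]) auto
  have vertices: "u (sg_vertex i) = 0" for i
    by (cases i rule: mod3_cases) (simp_all only: 0 1 2)
  have "has_laplacian u (laplacian u)"
    by (rule has_laplacian_laplacian[OF monomial_in_domain[OF u]])
  then have "has_laplacian u (\<lambda>_. 0)"
    by (rule has_laplacian_cong_right) (rule laplacian_monomial_0[OF u])
  then have zero: "u x = 0" if "x \<in> SG" for x
    by (rule harmonic_eq_0) (rule vertices, rule that)
  have "has_normal_derivative u (of_bool (k = 2)) 0"
    "has_tangential_derivative u (of_bool (k = 3)) 0"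
    using monomial_chain(3,4)[OF u order_refl] by simp_all
  then have "(\<lambda>m::nat. 0::real) \<longlonglongrightarrow> of_bool (k = 2)" "(\<lambda>m::nat. 0::real) \<longlonglongrightarrow> of_bool (k = 3)"
    unfolding has_normal_derivative_0_iff has_tangential_derivative_0_iff
    by (simp_all add: zero)
  then show False
    using k by (auto simp: LIMSEQ_const_iff)
qed

end

section \<open>Gram-Schmidt orthogonalization\<close>

text \<open>Only semidefiniteness is asked: functions are defined on the whole plane, and one that
  vanishes on \<open>SG\<close> has norm 0 without being the zero function.\<close>

locale semi_inner =
  fixes V :: "(plane \<Rightarrow> real) set" and ip :: "(plane \<Rightarrow> real) \<Rightarrow> (plane \<Rightarrow> real) \<Rightarrow> real"
  assumes add_closed: "u \<in> V \<Longrightarrow> v \<in> V \<Longrightarrow> (\<lambda>x. u x + v x) \<in> V"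
    and scale_closed: "u \<in> V \<Longrightarrow> (\<lambda>x. c * u x) \<in> V"
    and commute: "ip u v = ip v u"
    and add_left: "u \<in> V \<Longrightarrow> v \<in> V \<Longrightarrow> w \<in> V \<Longrightarrow> ip (\<lambda>x. u x + v x) w = ip u w + ip v w"
    and scale_left: "u \<in> V \<Longrightarrow> w \<in> V \<Longrightarrow> ip (\<lambda>x. c * u x) w = c * ip u w"
    and nonneg: "u \<in> V \<Longrightarrow> 0 \<le> ip u u"
begin

lemma add_right: "u \<in> V \<Longrightarrow> v \<in> V \<Longrightarrow> w \<in> V \<Longrightarrow> ip w (\<lambda>x. u x + v x) = ip w u + ip w v"
  by (simp add: commute[of w] add_left)

lemma scale_right: "u \<in> V \<Longrightarrow> w \<in> V \<Longrightarrow> ip w (\<lambda>x. c * u x) = c * ip w u"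
  by (simp add: commute[of w] scale_left)

lemma norm_add:
  assumes "u \<in> V" "v \<in> V"
  shows "ip (\<lambda>x. u x + v x) (\<lambda>x. u x + v x) = ip u u + 2 * ip u v + ip v v"
  using assms add_closed[OF assms] commute[of v u] by (simp add: add_left add_right)

lemma Cauchy_Schwarz:
  assumes u: "u \<in> V" and v: "v \<in> V"
  shows "(ip u v)\<^sup>2 \<le> ip u u * ip v v"
proof -
  have quad: "0 \<le> ip u u + 2 * t * ip u v + t\<^sup>2 * ip v v" for t
    using nonneg[OF add_closed[OF u scale_closed[OF v, of t]]]
      norm_add[OF u scale_closed[OF v, of t]] u v scale_closed[OF v, of t]
    by (simp add: scale_left scale_right power2_eq_square)
  show ?thesis
  proof (cases "ip v v = 0")
    case True
    have "ip u v = 0"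
    proof (rule ccontr)
      assume "ip u v \<noteq> 0"
      \<comment> \<open>For this \<open>t\<close> the quadratic, linear because
        \<open>ip v v = 0\<close>, takes the value -1.\<close>
      then show False
        using quad[of "- (ip u u + 1) / (2 * ip u v)"] True by (simp add: field_simps)
    qed
    with True show ?thesis
      by simp
  next
    case False
    then have "0 < ip v v"
      using nonneg[OF v] by simp
    then show ?thesis
      using quad[of "- ip u v / ip v v"] by (simp add: field_simps power2_eq_square)
  qed
qed

lemma zero_closed: "u \<in> V \<Longrightarrow> (\<lambda>_. 0) \<in> V"
  using scale_closed[of u 0] by simp

lemma sum_closed:
  fixes n :: nat
  shows "u \<in> V \<Longrightarrow> (\<And>i. i < n \<Longrightarrow> f i \<in> V) \<Longrightarrow> (\<lambda>x. u x + (\<Sum>i<n. c i * f i x)) \<in> V"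
proof (induction n)
  case (Suc n)
  then have "(\<lambda>x. u x + (\<Sum>i<n. c i * f i x)) \<in> V" "f n \<in> V"
    by simp_all
  from add_closed[OF this(1) scale_closed[OF this(2)]] show ?case
    by (simp add: add.assoc)
qed simp

lemma ip_sum_left:
  fixes n :: nat
  shows "u \<in> V \<Longrightarrow> w \<in> V \<Longrightarrow> (\<And>i. i < n \<Longrightarrow> f i \<in> V) \<Longrightarrow>
    ip (\<lambda>x. u x + (\<Sum>i<n. c i * f i x)) w = ip u w + (\<Sum>i<n. c i * ip (f i) w)"
proof (induction n)
  case (Suc n)
  have "(\<lambda>x. u x + (\<Sum>i<Suc n. c i * f i x)) = (\<lambda>x. (u x + (\<Sum>i<n. c i * f i x)) + c n * f n x)"
    by (simp add: add.assoc)
  then have "ip (\<lambda>x. u x + (\<Sum>i<Suc n. c i * f i x)) w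
      = ip (\<lambda>x. u x + (\<Sum>i<n. c i * f i x)) w + c n * ip (f n) w"
    using Suc.prems by (simp only: add_left scale_left sum_closed scale_closed lessI less_SucI)
  with Suc show ?case
    by simp
qed simp

end

section \<open>Monic Gram-Schmidt orthogonalization\<close>

lemma gram_schmidt_monic_eq:
  "gram_schmidt_monic ip P n = (\<lambda>x. P n x + (\<Sum>i<n.
     - (ip (P n) (gram_schmidt_monic ip P i)
        / ip (gram_schmidt_monic ip P i) (gram_schmidt_monic ip P i)) * gram_schmidt_monic ip P i x))"
  by (subst gram_schmidt_monic.simps) (simp add: sum_negf)

definition lower_span :: "(nat \<Rightarrow> plane \<Rightarrow> real) \<Rightarrow> nat \<Rightarrow> (plane \<Rightarrow> real) set" where
  "lower_span P n = {f. \<exists>c. f = (\<lambda>x. \<Sum>i<n. c i * P i x)}"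

lemma lower_spanI: "(\<lambda>x. \<Sum>i<n. c i * P i x) \<in> lower_span P n"
  by (auto simp: lower_span_def)

lemma lower_span_add:
  assumes "f \<in> lower_span P n" "g \<in> lower_span P n"
  shows "(\<lambda>x. f x + g x) \<in> lower_span P n"
proof -
  obtain c d where "f = (\<lambda>x. \<Sum>i<n. c i * P i x)" "g = (\<lambda>x. \<Sum>i<n. d i * P i x)"
    using assms by (auto simp: lower_span_def)
  then have "(\<lambda>x. f x + g x) = (\<lambda>x. \<Sum>i<n. (c i + d i) * P i x)"
    by (simp add: distrib_right sum.distrib)
  then show ?thesis
    by (simp only: lower_spanI)
qed

lemma lower_span_scale:
  assumes "f \<in> lower_span P n"
  shows "(\<lambda>x. b * f x) \<in> lower_span P n"
proof -
  obtain c where "f = (\<lambda>x. \<Sum>i<n. c i * P i x)"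
    using assms by (auto simp: lower_span_def)
  then have "(\<lambda>x. b * f x) = (\<lambda>x. \<Sum>i<n. (b * c i) * P i x)"
    by (simp add: sum_distrib_left mult.assoc)
  then show ?thesis
    by (simp only: lower_spanI)
qed

lemma lower_span_mono:
  assumes "f \<in> lower_span P m" "m \<le> n"
  shows "f \<in> lower_span P n"
proof -
  obtain c where f: "f = (\<lambda>x. \<Sum>i<m. c i * P i x)"
    using assms(1) by (auto simp: lower_span_def)
  have "(\<Sum>i<m. c i * P i x) = (\<Sum>i<n. (if i < m then c i else 0) * P i x)" for x
    using assms(2) by (intro sum.mono_neutral_cong_left) auto
  then have "f = (\<lambda>x. \<Sum>i<n. (if i < m then c i else 0) * P i x)"
    unfolding f by (rule ext)
  then show ?thesis
    by (simp only: lower_spanI)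
qed

lemma lower_span_member:
  assumes "i < n"
  shows "P i \<in> lower_span P n"
proof -
  have "P i x = (\<Sum>j<n. (if j = i then 1 else 0) * P j x)" for x
  proof -
    have "(\<Sum>j<n. (if j = i then 1 else 0) * P j x) = (\<Sum>j<n. if j = i then P j x else 0)"
      by (rule sum.cong) auto
    also have "\<dots> = P i x"
      using assms by simp
    finally show ?thesis ..
  qed
  then have "P i = (\<lambda>x. \<Sum>j<n. (if j = i then 1 else 0) * P j x)"
    by (rule ext)
  then show ?thesis
    by (simp only: lower_spanI)
qed

lemma lower_span_sum:
  fixes n :: nat
  shows "(\<And>i. i < n \<Longrightarrow> f i \<in> lower_span P m) \<Longrightarrow> (\<lambda>x. \<Sum>i<n. c i * f i x) \<in> lower_span P m"
proof (induction n)
  case 0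
  show ?case
    using lower_spanI[where n = m and c = "\<lambda>_. 0" and P = P] by simp
next
  case (Suc n)
  then have "(\<lambda>x. \<Sum>i<n. c i * f i x) \<in> lower_span P m" "f n \<in> lower_span P m"
    by simp_all
  from lower_span_add[OF this(1) lower_span_scale[OF this(2)]] show ?case
    by simp
qed

lemma gram_schmidt_monic_leading:
  "\<exists>f\<in>lower_span P n. gram_schmidt_monic ip P n = (\<lambda>x. P n x + f x)"
proof (induction n rule: less_induct)
  case (less n)
  have lower: "gram_schmidt_monic ip P i \<in> lower_span P n" if i: "i < n" for i
  proof -
    obtain f where "f \<in> lower_span P i" "gram_schmidt_monic ip P i = (\<lambda>x. P i x + f x)"
      using less[OF i] by blast
    then show ?thesis
      using lower_span_add[OF lower_span_member[OF i] lower_span_mono[of f P i n]] i by simp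
  qed
  let ?c = "\<lambda>i. - (ip (P n) (gram_schmidt_monic ip P i)
     / ip (gram_schmidt_monic ip P i) (gram_schmidt_monic ip P i))"
  have "(\<lambda>x. \<Sum>i<n. ?c i * gram_schmidt_monic ip P i x) \<in> lower_span P n"
    by (rule lower_span_sum) (rule lower)
  then show ?case
    by (rule bexI[rotated]) (rule gram_schmidt_monic_eq)
qed

context semi_inner
begin

context
  fixes P :: "nat \<Rightarrow> plane \<Rightarrow> real"
  assumes P: "\<And>i. P i \<in> V"
begin

lemma gram_schmidt_closed: "gram_schmidt_monic ip P n \<in> V"
proof (induction n rule: less_induct)
  case (less n)
  then show ?case
    by (subst gram_schmidt_monic_eq) (intro sum_closed P)
qed

lemma gram_schmidt_orthogonal:
  "i < n \<Longrightarrow> ip (gram_schmidt_monic ip P n) (gram_schmidt_monic ip P i) = 0"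
proof (induction n arbitrary: i rule: less_induct)
  case (less n)
  let ?S = "gram_schmidt_monic ip P"
  let ?c = "\<lambda>j. - (ip (P n) (?S j) / ip (?S j) (?S j))"
  have "ip (?S n) (?S i) = ip (P n) (?S i) + (\<Sum>j<n. ?c j * ip (?S j) (?S i))"
    by (subst gram_schmidt_monic_eq) (intro ip_sum_left P gram_schmidt_closed)
  also have "(\<Sum>j<n. ?c j * ip (?S j) (?S i)) = (\<Sum>j<n. if j = i then ?c i * ip (?S i) (?S i) else 0)"
  proof (rule sum.cong[OF refl])
    fix j assume "j \<in> {..<n}"
    then have "ip (?S j) (?S i) = 0" if "j \<noteq> i"
      using less.IH[of j i] less.IH[of i j] less.prems that commute[of "?S i" "?S j"]
      by (cases "i < j") auto
    then show "?c j * ip (?S j) (?S i) = (if j = i then ?c i * ip (?S i) (?S i) else 0)"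
      by auto
  qed
  also have "\<dots> = ?c i * ip (?S i) (?S i)"
    using less.prems by simp
  finally have eq: "ip (?S n) (?S i) = ip (P n) (?S i) + ?c i * ip (?S i) (?S i)" .
  show ?case
  proof (cases "ip (?S i) (?S i) = 0")
    \<comment> \<open>Division by zero makes the projection coefficient 0 here, so nothing is
      subtracted; Cauchy-Schwarz shows that nothing had to be.\<close>
    case True
    then have "ip (P n) (?S i) = 0"
      using Cauchy_Schwarz[OF P gram_schmidt_closed, of n i] by simp
    with eq True show ?thesis
      by simp
  next
    case False
    with eq show ?thesis
      by simp
  qed
qed

text \<open>The recursion read backwards: \<open>P i\<close> is a combination of the orthogonalized
  functions of index at most \<open>i\<close>.\<close>

lemma gram_schmidt_orthogonal_base:
  assumes "i < n"
  shows "ip (gram_schmidt_monic ip P n) (P i) = 0"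
proof -
  let ?S = "gram_schmidt_monic ip P"
  have "ip (?S i) (?S n) = ip (P i) (?S n)
      + (\<Sum>j<i. - (ip (P i) (?S j) / ip (?S j) (?S j)) * ip (?S j) (?S n))"
    by (subst (1) gram_schmidt_monic_eq) (intro ip_sum_left P gram_schmidt_closed)
  moreover have "ip (?S j) (?S n) = 0" if "j < n" for j
    using gram_schmidt_orthogonal[OF that] commute[of "?S j" "?S n"] by simp
  ultimately show ?thesis
    using assms commute[of "?S n" "P i"] by simp
qed

lemma lower_span_closed: "f \<in> lower_span P n \<Longrightarrow> f \<in> V"
  using sum_closed[OF zero_closed[OF P[of 0]] P] by (auto simp: lower_span_def)

lemma gram_schmidt_orthogonal_lower:
  assumes "f \<in> lower_span P n"
  shows "ip (gram_schmidt_monic ip P n) f = 0"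
proof -
  let ?S = "gram_schmidt_monic ip P n"
  obtain c where f: "f = (\<lambda>x. \<Sum>i<n. c i * P i x)"
    using assms by (auto simp: lower_span_def)
  have zero: "ip (\<lambda>_. 0) ?S = 0"
    using scale_left[OF P[of 0] gram_schmidt_closed, of 0 n] by simp
  have "ip f ?S = (\<Sum>i<n. c i * ip (P i) ?S)"
    using ip_sum_left[OF zero_closed[OF P[of 0]] gram_schmidt_closed[of n] P, where n = n and c = c]
    by (simp add: f zero)
  also have "\<dots> = 0"
    using gram_schmidt_orthogonal_base by (intro sum.neutral) (simp add: commute[of _ ?S])
  finally show ?thesis
    using commute[of ?S f] by simp
qed

text \<open>Pythagoras: a competitor with the same leading term differs from the Gram-Schmidt
  function by an element of the lower span, which is orthogonal to it.\<close>

lemma gram_schmidt_minimal: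
  assumes "f \<in> lower_span P n"
  shows "ip (gram_schmidt_monic ip P n) (gram_schmidt_monic ip P n)
    \<le> ip (\<lambda>x. P n x + f x) (\<lambda>x. P n x + f x)"
proof -
  let ?S = "gram_schmidt_monic ip P n"
  obtain g where g: "g \<in> lower_span P n" "?S = (\<lambda>x. P n x + g x)"
    using gram_schmidt_monic_leading by blast
  define h where "h x = f x + (- 1) * g x" for x
  have h: "h \<in> lower_span P n"
    unfolding h_def by (intro lower_span_add lower_span_scale assms g)
  have "(\<lambda>x. P n x + f x) = (\<lambda>x. ?S x + h x)"
    by (simp add: g(2) h_def)
  moreover have "ip (\<lambda>x. ?S x + h x) (\<lambda>x. ?S x + h x) = ip ?S ?S + ip h h"
    using norm_add[OF gram_schmidt_closed lower_span_closed[OF h]] gram_schmidt_orthogonal_lower[OF h]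
    by simp
  ultimately show ?thesis
    using nonneg[OF lower_span_closed[OF h]] by simp
qed

end

end

section \<open>Bounds for the Green operator\<close>

lemma l2_norm_square: "(l2_norm f)\<^sup>2 = l2_inner f f"
  by (simp add: l2_norm_def l2_inner_nonneg)

lemma l2_norm_nonneg: "0 \<le> l2_norm f"
  by (simp add: l2_norm_def l2_inner_nonneg)

interpretation continuous_l2: semi_inner "{f. continuous_on SG f}" l2_inner
  by unfold_locales
    (auto simp: l2_inner_add_left l2_inner_scale_left l2_inner_nonneg intro: l2_inner_commute
      continuous_on_add continuous_on_mult_left)

lemma kernel_integrable:
  fixes g :: "plane \<Rightarrow> plane \<Rightarrow> real"
  assumes g: "continuous_on (SG \<times> SG) (\<lambda>(x, y). g x y)"
  shows "integrable (sg_measure \<Otimes>\<^sub>M sg_measure) (\<lambda>(x, y). g x y)"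
proof -
  interpret pair_prob_space sg_measure sg_measure ..
  let ?M = "sg_measure \<Otimes>\<^sub>M sg_measure"
  have space: "space ?M = SG \<times> SG"
    by (simp add: space_pair_measure sg.space_eq)
  have id: "(\<lambda>x. x) \<in> borel_measurable sg_measure"
    by (intro sg.continuous_measurable continuous_on_id)
  have "(\<lambda>p. (fst p, snd p)) \<in> borel_measurable ?M"
    using measurable_compose[OF measurable_fst id] measurable_compose[OF measurable_snd id]
    by (rule borel_measurable_Pair)
  then have "(\<lambda>p. p) \<in> borel_measurable ?M"
    by simp
  \<comment> \<open>Extension by zero off the closed set \<open>SG \<times> SG\<close> gives a Borel
    function on the full product, composed here with the measurable identity.\<close>
  moreover have "(\<lambda>p. indicator (SG \<times> SG) p *\<^sub>R (case p of (x, y) \<Rightarrow> g x y)) \<in> borel_measurable borel"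
    by (intro borel_measurable_continuous_on_indicator g borel_closed closed_Times closed_SG)
  ultimately have "(\<lambda>p. indicator (SG \<times> SG) p *\<^sub>R (case p of (x, y) \<Rightarrow> g x y)) \<in> borel_measurable ?M"
    by (rule measurable_compose)
  then have meas: "(\<lambda>(x, y). g x y) \<in> borel_measurable ?M"
    by (rule measurable_cong[THEN iffD1, rotated]) (simp add: space)
  have "bounded ((\<lambda>(x, y). g x y) ` (SG \<times> SG))"
    by (intro compact_imp_bounded compact_continuous_image g compact_Times compact_SG)
  then obtain B where "\<And>p. p \<in> SG \<times> SG \<Longrightarrow> norm (case p of (x, y) \<Rightarrow> g x y) \<le> B"
    unfolding bounded_iff by blast
  then show ?thesis
    by (intro P.integrable_const_bound[of _ B] AE_I2 meas) (simp add: space)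
qed

context gasket_green
begin

lemma green_continuous: "continuous_on (SG \<times> SG) (\<lambda>(x, y). G x y)"
  using green by (simp add: green_function_def)

lemma green_continuous_right:
  assumes "x \<in> SG"
  shows "continuous_on SG (G x)"
proof -
  have "continuous_on SG (\<lambda>y. case (x, y) of (x, y) \<Rightarrow> G x y)"
    by (rule continuous_on_compose2[OF green_continuous]) (use assms in \<open>auto intro!: continuous_intros\<close>)
  then show ?thesis
    by simp
qed

lemma green_square_bound:
  assumes u: "has_laplacian u f" "\<And>i. u (sg_vertex i) = 0" and x: "x \<in> SG"
  shows "(u x)\<^sup>2 \<le> l2_inner (G x) (G x) * l2_inner f f"
proof -
  have "u x = - l2_inner (G x) f"
    using green_representation[OF u x] by (simp add: l2_inner_def)
  then show ?thesis
    using continuous_l2.Cauchy_Schwarz[of "G x" f] green_continuous_right[OF x] has_laplacianD(2)[OF u(1)]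
    by simp
qed

lemma l2_norm_kernel_square:
  "(l2_norm_kernel G)\<^sup>2 = (\<integral>x. l2_inner (G x) (G x) \<partial>sg_measure)"
  "integrable sg_measure (\<lambda>x. l2_inner (G x) (G x))"
proof -
  interpret pair_prob_space sg_measure sg_measure ..
  have "continuous_on (SG \<times> SG) (\<lambda>p. (case p of (x, y) \<Rightarrow> G x y) * (case p of (x, y) \<Rightarrow> G x y))"
    by (intro continuous_on_mult green_continuous)
  then have cont: "continuous_on (SG \<times> SG) (\<lambda>(x, y). G x y * G x y)"
    by (simp add: case_prod_unfold)
  note int = kernel_integrable[OF cont]
  have "(l2_norm_kernel G)\<^sup>2 = (\<integral>(x, y). G x y * G x y \<partial>(sg_measure \<Otimes>\<^sub>M sg_measure))"
    unfolding l2_norm_kernel_def power2_eq_square[of "G _ _"]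
    by (intro real_sqrt_pow2 integral_nonneg_AE) auto
  also have "\<dots> = (\<integral>x. l2_inner (G x) (G x) \<partial>sg_measure)"
    unfolding l2_inner_def using integral_fst'[OF int] by simp
  finally show "(l2_norm_kernel G)\<^sup>2 = (\<integral>x. l2_inner (G x) (G x) \<partial>sg_measure)" .
  show "integrable sg_measure (\<lambda>x. l2_inner (G x) (G x))"
    unfolding l2_inner_def using integrable_fst'[OF int] by simp
qed

text \<open>The Hilbert-Schmidt estimate: the pointwise Cauchy-Schwarz bound integrated in
  \<open>x\<close>.\<close>

lemma green_l2_bound:
  assumes u: "has_laplacian u f" "\<And>i. u (sg_vertex i) = 0"
  shows "l2_inner u u \<le> (l2_norm_kernel G)\<^sup>2 * l2_inner f f"
proof -
  have "l2_inner u u \<le> (\<integral>x. l2_inner (G x) (G x) * l2_inner f f \<partial>sg_measure)"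
    unfolding l2_inner_def[of u u]
  proof (rule integral_mono)
    show "integrable sg_measure (\<lambda>x. u x * u x)"
      using has_laplacianD(3)[OF u(1)] by (intro continuous_mult_integrable)
    show "integrable sg_measure (\<lambda>x. l2_inner (G x) (G x) * l2_inner f f)"
      by (intro integrable_mult_left l2_norm_kernel_square)
    show "u x * u x \<le> l2_inner (G x) (G x) * l2_inner f f" if "x \<in> space sg_measure" for x
      using green_square_bound[OF u, of x] that by (simp add: sg.space_eq power2_eq_square)
  qed
  then show ?thesis
    by (simp add: l2_norm_kernel_square(1))
qed

text \<open>\<open>M\<close> bounds the continuous kernel on the compact product; total mass 1 then
  bounds the norm of each \<open>G x\<close> by \<open>M\<close>.\<close>

lemma green_sup_bound:
  obtains M where "0 < M"
    "\<And>u f x. has_laplacian u f \<Longrightarrow> (\<And>i. u (sg_vertex i) = 0) \<Longrightarrow> x \<in> SG \<Longrightarrow> \<bar>u x\<bar> \<le> M * l2_norm f"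
proof -
  have "bounded ((\<lambda>(x, y). G x y) ` (SG \<times> SG))"
    by (intro compact_imp_bounded compact_continuous_image green_continuous compact_Times compact_SG)
  then obtain M where pos: "0 < M" and bound: "\<forall>z\<in>(\<lambda>(x, y). G x y) ` (SG \<times> SG). norm z \<le> M"
    unfolding bounded_pos by blast
  have M: "\<bar>G x y\<bar> \<le> M" if "x \<in> SG" "y \<in> SG" for x y
    using bound that by fastforce
  have "\<bar>u x\<bar> \<le> M * l2_norm f"
    if u: "has_laplacian u f" "\<And>i. u (sg_vertex i) = 0" and x: "x \<in> SG" for u f x
  proof -
    have "l2_inner (G x) (G x) \<le> (\<integral>y. M\<^sup>2 \<partial>sg_measure)"
      unfolding l2_inner_def
    proof (rule integral_mono)
      show "integrable sg_measure (\<lambda>y. G x y * G x y)"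
        using green_continuous_right[OF x] by (intro continuous_mult_integrable)
      show "G x y * G x y \<le> M\<^sup>2" if "y \<in> space sg_measure" for y
      proof -
        have "\<bar>G x y\<bar> \<le> \<bar>M\<bar>"
          using pos M[OF x, of y] that by (simp add: sg.space_eq)
        then show ?thesis
          unfolding abs_le_square_iff power2_eq_square .
      qed
    qed simp
    then have "l2_inner (G x) (G x) \<le> M\<^sup>2"
      by (simp add: sg.prob_space)
    then have "l2_inner (G x) (G x) * l2_inner f f \<le> M\<^sup>2 * l2_inner f f"
      by (rule mult_right_mono[OF _ l2_inner_nonneg])
    with green_square_bound[OF u x] have "(u x)\<^sup>2 \<le> M\<^sup>2 * l2_inner f f"
      by (rule order_trans)
    also have "\<dots> = (M * l2_norm f)\<^sup>2"
      by (simp add: power_mult_distrib l2_norm_square)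
    finally have "\<bar>u x\<bar> \<le> \<bar>M * l2_norm f\<bar>"
      unfolding abs_le_square_iff .
    then show ?thesis
      using pos by (simp add: abs_mult l2_norm_nonneg)
  qed
  then show ?thesis
    by (rule that[OF pos])
qed

end

section \<open>Legendre and Sobolev-Legendre polynomials\<close>

interpretation laplacian_l2: semi_inner laplacian_domain l2_inner
  by unfold_locales
    (auto simp: l2_inner_add_left l2_inner_scale_left l2_inner_nonneg laplacian_domain_continuous
      intro: l2_inner_commute laplacian_domain_add laplacian_domain_scale)

lemma semi_inner_sobolev:
  assumes "0 \<le> chi"
  shows "semi_inner laplacian_domain (sobolev_inner chi)"
proof
  show "sobolev_inner chi u v = sobolev_inner chi v u" for u v
    by (simp add: sobolev_inner_def l2_inner_commute[of u v]
        l2_inner_commute[of "laplacian u" "laplacian v"])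
  show "0 \<le> sobolev_inner chi u u" for u
    using assms by (simp add: sobolev_inner_def l2_inner_nonneg)
  fix u v w c assume u: "u \<in> laplacian_domain" and w: "w \<in> laplacian_domain"
  show "(\<lambda>x. c * u x) \<in> laplacian_domain"
    by (rule laplacian_domain_scale[OF u])
  have "l2_inner (laplacian (\<lambda>x. c * u x)) (laplacian w)
      = l2_inner (\<lambda>x. c * laplacian u x) (laplacian w)"
    by (rule l2_inner_cong[OF laplacian_scale[OF u] refl])
  then show "sobolev_inner chi (\<lambda>x. c * u x) w = c * sobolev_inner chi u w"
    by (simp add: sobolev_inner_def l2_inner_scale_left algebra_simps)
  assume v: "v \<in> laplacian_domain"
  show "(\<lambda>x. u x + v x) \<in> laplacian_domain"
    by (rule laplacian_domain_add[OF u v])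
  have "l2_inner (laplacian (\<lambda>x. u x + v x)) (laplacian w)
      = l2_inner (\<lambda>x. laplacian u x + laplacian v x) (laplacian w)"
    by (rule l2_inner_cong[OF laplacian_add[OF u v] refl])
  then show "sobolev_inner chi (\<lambda>x. u x + v x) w = sobolev_inner chi u w + sobolev_inner chi v w"
    using u v w by (simp add: sobolev_inner_def l2_inner_add_left laplacian_domain_continuous
        continuous_on_laplacian algebra_simps)
qed

text \<open>The sign \<open>s\<close> is the parity of the family under reflection; carrying it
  along treats \<open>k = 2\<close> and \<open>k = 3\<close> at once.\<close>

locale monomial_family = gasket_green G for G :: "plane \<Rightarrow> plane \<Rightarrow> real" +
  fixes k :: nat and s :: real and P :: "nat \<Rightarrow> plane \<Rightarrow> real"
  assumes k: "k = 2 \<and> s = 1 \<or> k = 3 \<and> s = - 1"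
    and monomial: "\<And>j. monomial_function j k (P j)"
begin

lemma P_domain: "P j \<in> laplacian_domain"
  by (rule monomial_in_domain[OF monomial])

lemma laplacian_P_0: "x \<in> SG \<Longrightarrow> laplacian (P 0) x = 0"
  by (rule laplacian_monomial_0[OF monomial])

lemma has_laplacian_P_Suc: "has_laplacian (P (Suc j)) (P j)"
  by (rule has_laplacian_cong_right[OF has_laplacian_laplacian[OF P_domain]])
    (rule laplacian_monomial_Suc[OF monomial monomial])

lemma has_laplacian_P_0: "has_laplacian (P 0) (\<lambda>_. 0)"
  by (rule has_laplacian_cong_right[OF has_laplacian_laplacian[OF P_domain]]) (rule laplacian_P_0)

lemma P_vertex_1: "P 0 (sg_vertex 1) \<noteq> 0"
  by (rule monomial_0_vertex_1[OF monomial k])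

text \<open>By reflection symmetry, the boundary values of a polynomial of the family are determined by
  the one at \<open>q\<^sub>1\<close>; subtracting a multiple of \<open>P\<^sub>0\<close> thus makes it vanish on the boundary.\<close>

definition boundary_symmetric :: "(plane \<Rightarrow> real) \<Rightarrow> bool" where
  "boundary_symmetric f \<longleftrightarrow> f (sg_vertex 0) = 0 \<and> f (sg_vertex 2) = s * f (sg_vertex 1)"

lemma boundary_symmetric_P: "boundary_symmetric (P j)"
  unfolding boundary_symmetric_def
  using monomial_vertex_0[OF monomial] monomial_vertex_2[OF monomial k] k by auto

lemma boundary_symmetric_add:
  "boundary_symmetric f \<Longrightarrow> boundary_symmetric g \<Longrightarrow> boundary_symmetric (\<lambda>x. f x + g x)"
  by (simp add: boundary_symmetric_def distrib_left)

lemma boundary_symmetric_scale: "boundary_symmetric f \<Longrightarrow> boundary_symmetric (\<lambda>x. c * f x)"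
  by (simp add: boundary_symmetric_def)

lemma boundary_symmetric_lower_span: "f \<in> lower_span P n \<Longrightarrow> boundary_symmetric f"
proof -
  assume "f \<in> lower_span P n"
  then obtain c where f: "f = (\<lambda>x. \<Sum>i<n. c i * P i x)"
    by (auto simp: lower_span_def)
  have "boundary_symmetric (\<lambda>x. \<Sum>i<n. c i * P i x)"
    by (induction n) (simp_all add: boundary_symmetric_add boundary_symmetric_scale
        boundary_symmetric_P, simp add: boundary_symmetric_def)
  with f show ?thesis
    by simp
qed

lemma boundary_symmetric_correction:
  assumes "boundary_symmetric f"
  shows "f (sg_vertex i) - f (sg_vertex 1) / P 0 (sg_vertex 1) * P 0 (sg_vertex i) = 0"
  using assms boundary_symmetric_P[of 0] P_vertex_1
  by (cases i rule: mod3_cases) (simp_all add: boundary_symmetric_def)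

text \<open>Raising every index by one gives a primitive. The length \<open>n\<close> is separate
  from the leading index \<open>m\<close> so that it can be the induction variable.\<close>

lemma has_laplacian_shift_sum:
  "has_laplacian (\<lambda>x. P (Suc m) x + (\<Sum>i<n. c i * P (Suc i) x)) (\<lambda>x. P m x + (\<Sum>i<n. c i * P i x))"
proof (induction n)
  case 0
  show ?case
    using has_laplacian_P_Suc by simp
next
  case (Suc n)
  from has_laplacian_add[OF Suc has_laplacian_scale[OF has_laplacian_P_Suc]] show ?case
    by (simp add: add.assoc)
qed

lemma ex_dirichlet_primitive:
  "\<exists>f\<in>lower_span P (Suc m). has_laplacian (\<lambda>x. P (Suc m) x + f x) (legendre P m) \<and>
     (\<forall>i. P (Suc m) (sg_vertex i) + f (sg_vertex i) = 0)"
proof -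
  obtain g where g: "g \<in> lower_span P m" "legendre P m = (\<lambda>x. P m x + g x)"
    unfolding legendre_def using gram_schmidt_monic_leading by blast
  then obtain c where c: "legendre P m = (\<lambda>x. P m x + (\<Sum>i<m. c i * P i x))"
    by (auto simp: lower_span_def)
  \<comment> \<open>The shifted terms use the indices 1 to \<open>m\<close>, leaving index 0 free
    for the harmonic correction.\<close>
  define h where "h x = (\<Sum>i<m. c i * P (Suc i) x)" for x
  have h: "h \<in> lower_span P (Suc m)"
    unfolding h_def by (intro lower_span_sum lower_span_member) simp
  \<comment> \<open>Chosen to cancel the value at q_1; by symmetry the other corners follow, and the
    Laplacian is unchanged as \<open>P 0\<close> is harmonic.\<close>
  define t where "t = (P (Suc m) (sg_vertex 1) + h (sg_vertex 1)) / P 0 (sg_vertex 1)"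
  define f where "f x = h x + (- t) * P 0 x" for x
  have "f \<in> lower_span P (Suc m)"
    unfolding f_def by (intro lower_span_add lower_span_scale lower_span_member h) simp
  moreover have "has_laplacian (\<lambda>x. P (Suc m) x + f x) (legendre P m)"
    using has_laplacian_add[OF has_laplacian_shift_sum[of m c m]
        has_laplacian_scale[OF has_laplacian_P_0, of "- t"]]
    unfolding c f_def h_def by (simp add: add_diff_eq)
  moreover have "P (Suc m) (sg_vertex i) + f (sg_vertex i) = 0" for i
    using boundary_symmetric_correction[OF boundary_symmetric_add[OF boundary_symmetric_P
          boundary_symmetric_lower_span[OF h]], of "Suc m" i]
    by (simp add: f_def t_def)
  ultimately show ?thesis
    by blast
qed

lemma sobolev_legendre_domain:
  assumes "0 \<le> chi"
  shows "sobolev_legendre chi P n \<in> laplacian_domain"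
  unfolding sobolev_legendre_def
  by (rule semi_inner.gram_schmidt_closed[OF semi_inner_sobolev[OF assms] P_domain])

lemma boundary_symmetric_sobolev_legendre: "boundary_symmetric (sobolev_legendre chi P n)"
proof -
  obtain f where "f \<in> lower_span P n" "sobolev_legendre chi P n = (\<lambda>x. P n x + f x)"
    unfolding sobolev_legendre_def using gram_schmidt_monic_leading by blast
  then show ?thesis
    by (simp add: boundary_symmetric_add boundary_symmetric_P boundary_symmetric_lower_span)
qed

text \<open>The Laplacian part of the Sobolev norm is bounded by the whole, the whole by that of the
  competitor \<open>?q\<close>, and this by the Hilbert-Schmidt estimate; the factor
  \<open>chi\<close> is divided out at the end.\<close>

lemma laplacian_sobolev_legendre_bound:
  assumes chi: "0 < chi"
  shows "(l2_norm (laplacian (sobolev_legendre chi P (Suc m))))\<^sup>2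
    \<le> (1 + inverse chi * (l2_norm_kernel G)\<^sup>2) * (l2_norm (legendre P m))\<^sup>2"
proof -
  interpret S: semi_inner laplacian_domain "sobolev_inner chi"
    using chi by (intro semi_inner_sobolev) simp
  let ?s = "sobolev_legendre chi P (Suc m)" and ?p = "legendre P m"
  obtain f where f: "f \<in> lower_span P (Suc m)" "has_laplacian (\<lambda>x. P (Suc m) x + f x) ?p"
    "\<And>i. P (Suc m) (sg_vertex i) + f (sg_vertex i) = 0"
    using ex_dirichlet_primitive by blast
  let ?q = "\<lambda>x. P (Suc m) x + f x"
  have lap: "l2_inner (laplacian ?q) (laplacian ?q) = l2_inner ?p ?p"
    by (rule l2_inner_cong; rule laplacian_eqI[OF f(2)])
  have "chi * l2_inner (laplacian ?s) (laplacian ?s) \<le> sobolev_inner chi ?s ?s"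
    using l2_inner_nonneg[of ?s] by (simp add: sobolev_inner_def)
  also have "\<dots> \<le> sobolev_inner chi ?q ?q"
    unfolding sobolev_legendre_def by (rule S.gram_schmidt_minimal[OF P_domain f(1)])
  also have "\<dots> = l2_inner ?q ?q + chi * l2_inner ?p ?p"
    by (simp add: sobolev_inner_def lap)
  also have "\<dots> \<le> (l2_norm_kernel G)\<^sup>2 * l2_inner ?p ?p + chi * l2_inner ?p ?p"
    using green_l2_bound[OF f(2,3)] by simp
  finally show ?thesis
    using chi by (simp add: l2_norm_square field_simps)
qed

lemma sobolev_legendre_sup_bound:
  obtains K where "0 < K" "\<And>chi n x. 0 < chi \<Longrightarrow> 0 < n \<Longrightarrow> x \<in> SG \<Longrightarrow>
    \<bar>sobolev_legendre chi P n x\<bar> \<le> K * l2_norm (laplacian (sobolev_legendre chi P n))"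
proof -
  define N where "N = l2_norm_kernel G"
  define b where "b = l2_norm (P 0)"
  have N: "0 \<le> N"
    by (simp add: N_def l2_norm_kernel_def integral_nonneg_AE case_prod_unfold)
  obtain M where M: "0 < M" "\<And>u f x. has_laplacian u f \<Longrightarrow> (\<And>i. u (sg_vertex i) = 0) \<Longrightarrow> x \<in> SG
      \<Longrightarrow> \<bar>u x\<bar> \<le> M * l2_norm f"
    using green_sup_bound by blast
  obtain B where B: "0 < B" "\<And>x. x \<in> SG \<Longrightarrow> \<bar>P 0 x\<bar> \<le> B"
    using bounded_on_SG[OF laplacian_domain_continuous[OF P_domain]] by blast
  have b: "0 < b"
  proof -
    have "l2_inner (P 0) (P 0) \<noteq> 0"
      using l2_inner_eq_0_imp[OF laplacian_domain_continuous[OF P_domain] _ sg_vertex_in_SG] P_vertex_1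
      by blast
    then show ?thesis
      using l2_inner_nonneg[of "P 0"] by (simp add: b_def l2_norm_def)
  qed
  show ?thesis
  \<comment> \<open>\<open>M\<close> accounts for the part \<open>r\<close> with zero boundary
    values, \<open>N * B / b\<close> for the multiple \<open>c\<close> of \<open>P 0\<close>:
    orthogonality to \<open>P 0\<close> bounds \<open>c\<close> by \<open>N * L / b\<close>, and
    \<open>B\<close> bounds \<open>P 0\<close>.\<close>
  proof (rule that[of "N * B / b + M"])
    show "0 < N * B / b + M"
      using N B(1) b M(1) by (intro add_nonneg_pos) auto
    fix chi :: real and n :: nat and x
    assume chi: "0 < chi" and n: "0 < n" and x: "x \<in> SG"
    interpret S: semi_inner laplacian_domain "sobolev_inner chi"
      using chi by (intro semi_inner_sobolev) simp
    define u where "u = sobolev_legendre chi P n"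
    define c where "c = u (sg_vertex 1) / P 0 (sg_vertex 1)"
    define r where "r y = u y - c * P 0 y" for y
    define L where "L = l2_norm (laplacian u)"
    have u: "u \<in> laplacian_domain"
      unfolding u_def using chi by (intro sobolev_legendre_domain) simp
    have lap: "has_laplacian r (laplacian u)"
      using has_laplacian_diff[OF has_laplacian_laplacian[OF u] has_laplacian_scale[OF has_laplacian_P_0]]
      unfolding r_def by simp
    have vertex: "r (sg_vertex i) = 0" for i
      unfolding r_def c_def u_def
      by (rule boundary_symmetric_correction[OF boundary_symmetric_sobolev_legendre])
    have r: "r \<in> laplacian_domain"
      by (rule laplacian_domainI[OF lap])
    \<comment> \<open>The Laplacian of \<open>P 0\<close> vanishes, so the \<open>chi\<close> term
      of the Sobolev product drops out.\<close>
    have orth: "l2_inner u (P 0) = 0"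
    proof -
      have "l2_inner (laplacian u) (laplacian (P 0)) = l2_inner (laplacian u) (\<lambda>_. 0)"
        by (rule l2_inner_cong[OF refl laplacian_P_0])
      moreover have "sobolev_inner chi u (P 0) = 0"
        unfolding u_def sobolev_legendre_def by (rule S.gram_schmidt_orthogonal_base[OF P_domain n])
      ultimately show ?thesis
        by (simp add: sobolev_inner_def l2_inner_def[of _ "\<lambda>_. 0"])
    qed
    have "u = (\<lambda>y. r y + c * P 0 y)"
      by (simp add: r_def)
    then have "l2_inner r (P 0) + c * b\<^sup>2 = 0"
      using orth laplacian_l2.add_left[OF r laplacian_domain_scale[OF P_domain] P_domain, of c 0 0]
      by (simp add: l2_inner_scale_left b_def l2_norm_square)
    then have "(c * b\<^sup>2)\<^sup>2 = (l2_inner r (P 0))\<^sup>2"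
      by (simp add: eq_neg_iff_add_eq_0[symmetric] add.commute)
    also have "\<dots> \<le> l2_inner r r * l2_inner (P 0) (P 0)"
      by (rule laplacian_l2.Cauchy_Schwarz[OF r P_domain])
    also have "\<dots> \<le> N\<^sup>2 * l2_inner (laplacian u) (laplacian u) * l2_inner (P 0) (P 0)"
      unfolding N_def by (intro mult_right_mono green_l2_bound lap vertex l2_inner_nonneg)
    also have "\<dots> = (N * L * b)\<^sup>2"
      by (simp add: L_def b_def power_mult_distrib l2_norm_square)
    finally have "\<bar>c * b\<^sup>2\<bar> \<le> \<bar>N * L * b\<bar>"
      by (simp only: abs_le_square_iff)
    then have "\<bar>c\<bar> * b * b \<le> N * L * b"
      using N b by (simp add: abs_mult L_def l2_norm_nonneg power2_eq_square mult.assoc)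
    then have "\<bar>c\<bar> * b \<le> N * L"
      using b by simp
    then have c: "\<bar>c\<bar> \<le> N * L / b"
      using b by (simp add: pos_le_divide_eq)
    have "\<bar>u x\<bar> \<le> \<bar>c\<bar> * \<bar>P 0 x\<bar> + \<bar>r x\<bar>"
      using abs_triangle_ineq[of "c * P 0 x" "r x"] by (simp add: r_def abs_mult)
    also have "\<dots> \<le> N * L / b * B + M * L"
      using c B x M(2)[OF lap vertex x] by (intro add_mono mult_mono') (auto simp: L_def)
    also have "\<dots> = (N * B / b + M) * L"
      by (simp add: field_simps)
    finally show "\<bar>sobolev_legendre chi P n x\<bar>
        \<le> (N * B / b + M) * l2_norm (laplacian (sobolev_legendre chi P n))"
      by (simp add: u_def L_def)
  qed
qed

lemma sobolev_legendre_estimates: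
  "\<exists>C>0. \<forall>n\<ge>1. \<forall>chi>0.
      (l2_norm (laplacian (sobolev_legendre chi P n)))\<^sup>2
        \<le> (1 + inverse chi * (l2_norm_kernel G)\<^sup>2) * (l2_norm (legendre P (n - 1)))\<^sup>2 \<and>
      sup_norm (sobolev_legendre chi P n)
        \<le> C * (1 + chi powr (- 1 / 2)) * l2_norm (legendre P (n - 1))"
proof -
  define N where "N = l2_norm_kernel G"
  have N: "0 \<le> N"
    by (simp add: N_def l2_norm_kernel_def integral_nonneg_AE case_prod_unfold)
  obtain K where K: "0 < K" "\<And>chi n x. 0 < chi \<Longrightarrow> 0 < n \<Longrightarrow> x \<in> SG \<Longrightarrow>
      \<bar>sobolev_legendre chi P n x\<bar> \<le> K * l2_norm (laplacian (sobolev_legendre chi P n))"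
    using sobolev_legendre_sup_bound by blast
  show ?thesis
  \<comment> \<open>With \<open>t\<close> the power -1/2 of \<open>chi\<close>, the root of
    \<open>1 + t\<^sup>2 * N\<^sup>2\<close> is at most \<open>1 + t * N\<close>, and this is at
    most \<open>(1 + N) * (1 + t)\<close>.\<close>
  proof (intro exI[of _ "K * (1 + N)"] conjI allI impI)
    show "0 < K * (1 + N)"
      using K(1) N by simp
    fix n :: nat and chi :: real
    assume n: "1 \<le> n" and chi: "0 < chi"
    let ?s = "sobolev_legendre chi P n" and ?p = "legendre P (n - 1)"
    define t where "t = chi powr (- 1 / 2)"
    have "t\<^sup>2 = chi powr (- 1)"
      using powr_add[of chi "- 1 / 2" "- 1 / 2"] by (simp add: t_def power2_eq_square)
    then have t: "0 < t" "t\<^sup>2 = inverse chi"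
      using chi by (simp_all add: t_def powr_minus)
    have "(1 + t * N)\<^sup>2 = 1 + 2 * (t * N) + inverse chi * N\<^sup>2"
      by (simp add: power2_sum power_mult_distrib t(2))
    then have square: "1 + inverse chi * (l2_norm_kernel G)\<^sup>2 \<le> (1 + t * N)\<^sup>2"
      unfolding N_def[symmetric] using t(1) N by simp
    show *: "(l2_norm (laplacian ?s))\<^sup>2 \<le> (1 + inverse chi * (l2_norm_kernel G)\<^sup>2) * (l2_norm ?p)\<^sup>2"
      using laplacian_sobolev_legendre_bound[OF chi, of "n - 1"] n by simp
    also have "\<dots> \<le> ((1 + t * N) * l2_norm ?p)\<^sup>2"
      unfolding power_mult_distrib[of _ "l2_norm ?p"]
      by (rule mult_right_mono[OF square]) simp
    finally have "l2_norm (laplacian ?s) \<le> (1 + t * N) * l2_norm ?p"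
      by (rule power2_le_imp_le) (use t(1) N in \<open>simp add: l2_norm_nonneg\<close>)
    also have "\<dots> \<le> ((1 + N) * (1 + t)) * l2_norm ?p"
      using t(1) N by (intro mult_right_mono l2_norm_nonneg) (simp add: algebra_simps)
    finally have bound: "l2_norm (laplacian ?s) \<le> (1 + N) * (1 + t) * l2_norm ?p" .
    show "sup_norm ?s \<le> K * (1 + N) * (1 + chi powr (- 1 / 2)) * l2_norm ?p"
      unfolding sup_norm_def
    proof (rule cSUP_least[OF SG_nonempty])
      fix x assume x: "x \<in> SG"
      have "\<bar>?s x\<bar> \<le> K * l2_norm (laplacian ?s)"
        using n by (intro K(2) chi x) simp
      also have "\<dots> \<le> K * ((1 + N) * (1 + t) * l2_norm ?p)"
        using K(1) by (intro mult_left_mono bound) simp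
      finally show "\<bar>?s x\<bar> \<le> K * (1 + N) * (1 + chi powr (- 1 / 2)) * l2_norm ?p"
        by (simp add: t_def mult.assoc)
    qed
  qed
qed

end

theorem corollary3p2:
  fixes k :: nat
    and G :: "plane \<Rightarrow> plane \<Rightarrow> real"
    and P :: "nat \<Rightarrow> plane \<Rightarrow> real"
  assumes "k = 2 \<or> k = 3"
    and "green_function G"
    and "\<And>j. monomial_function j k (P j)"
  shows "\<exists>C>0. \<forall>n\<ge>1. \<forall>chi>0.
      (l2_norm (laplacian (sobolev_legendre chi P n)))\<^sup>2
        \<le> (1 + inverse chi * (l2_norm_kernel G)\<^sup>2) * (l2_norm (legendre P (n - 1)))\<^sup>2 \<and>
      sup_norm (sobolev_legendre chi P n)
        \<le> C * (1 + chi powr (- 1 / 2)) * l2_norm (legendre P (n - 1))"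
proof -
  interpret monomial_family G k "if k = 2 then 1 else - 1" P
    using assms by unfold_locales auto
  show ?thesis
    by (rule sobolev_legendre_estimates)
qed

end
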